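(* There exists an uncountable family $(G_r)_{r\in\mathbb{R}}$ of finitely generated amenable groups of asymptotic dimension one such that for any $r\neq s$ there is no regular map from $G_s$ to $G_r$.
   Context: A map $F\colon VX\to VY$ between bounded degree graphs is regular if there exists a constant $\kappa$ such that $d(F(x),F(x'))\leq\kappa\, d(x,x')$ for all $x,x'\in VX$, and $|F^{-1}(\{y\})|\leq\kappa$ for every $y\in VY$. A finitely generated group is identified with any of its Cayley graphs with respect to a finite generating set (the existence of a regular map does not depend on the choice). *)

theory Defs
  imports "HOL-Algebra.Generated_Groups" "HOL-Library.Extended_Nat" Complex_Main
begin

(* A graph is given by a vertex set V and a symmetric edge relation E on V.  The distance
   is infinite between vertices in different components, since Inf {} is infinity in enat. *)

definition graph_dist :: "('a \<times> 'a) set \<Rightarrow> 'a \<Rightarrow> 'a \<Rightarrow> enat" where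
  "graph_dist E x y = (INF n \<in> {n. (x, y) \<in> E ^^ n}. enat n)"

(* Distances are integers or infinite, so a real constant may be rounded up to a natural
   number.  Finiteness of the fibres is explicit because infinite sets have card 0. *)

definition regular_map ::
  "'a set \<Rightarrow> ('a \<times> 'a) set \<Rightarrow> 'b set \<Rightarrow> ('b \<times> 'b) set \<Rightarrow> ('a \<Rightarrow> 'b) \<Rightarrow> bool" where
  "regular_map V E W E' F \<longleftrightarrow> F \<in> V \<rightarrow> W \<and>
     (\<exists>\<kappa>::nat.
        (\<forall>x\<in>V. \<forall>x'\<in>V. graph_dist E' (F x) (F x') \<le> enat \<kappa> * graph_dist E x x') \<and>
        (\<forall>y\<in>W. finite {x \<in> V. F x = y} \<and> card {x \<in> V. F x = y} \<le> \<kappa>))"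

definition finite_generating_set :: "('a, 'm) monoid_scheme \<Rightarrow> 'a set \<Rightarrow> bool" where
  "finite_generating_set G S \<longleftrightarrow> finite S \<and> S \<subseteq> carrier G \<and> generate G S = carrier G"

definition finitely_generated_group :: "('a, 'm) monoid_scheme \<Rightarrow> bool" where
  "finitely_generated_group G \<longleftrightarrow> group G \<and> (\<exists>S. finite_generating_set G S)"

(* The undirected Cayley graph: g is adjacent to g s and to g s^-1 for s in S.  A loop arising
   from the identity in S does not affect the graph distance. *)

definition cayley_edges :: "('a, 'm) monoid_scheme \<Rightarrow> 'a set \<Rightarrow> ('a \<times> 'a) set" where
  "cayley_edges G S =
     {(x, y). x \<in> carrier G \<and> y \<in> carrier G \<and>
        (\<exists>s\<in>S. y = x \<otimes>\<^bsub>G\<^esub> s \<or> x = y \<otimes>\<^bsub>G\<^esub> s)}"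

(* The existence of a regular map does not depend on the generating sets, so the existential
   quantifiers over S and T below could equivalently be universal. *)

definition regular_map_exists ::
  "('a, 'm) monoid_scheme \<Rightarrow> ('b, 'n) monoid_scheme \<Rightarrow> bool" where
  "regular_map_exists G H \<longleftrightarrow>
     (\<exists>S T F. finite_generating_set G S \<and> finite_generating_set H T \<and>
        regular_map (carrier G) (cayley_edges G S) (carrier H) (cayley_edges H T) F)"

(* Amenability of a discrete group: a left-invariant finitely additive probability measure
   defined on all subsets of the group. *)

definition amenable_group :: "('a, 'm) monoid_scheme \<Rightarrow> bool" where
  "amenable_group G \<longleftrightarrow> group G \<and>
     (\<exists>m :: 'a set \<Rightarrow> real.
        (\<forall>A \<subseteq> carrier G. 0 \<le> m A) \<and>
        m (carrier G) = 1 \<and>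
        (\<forall>A \<subseteq> carrier G. \<forall>B \<subseteq> carrier G. A \<inter> B = {} \<longrightarrow> m (A \<union> B) = m A + m B) \<and>
        (\<forall>g \<in> carrier G. \<forall>A \<subseteq> carrier G. m (g <#\<^bsub>G\<^esub> A) = m A))"

(* Gromov's definition: for every R there is a uniformly bounded cover that splits into
   n + 1 families U 0, ..., U n, each of them R-disjoint.  Natural R and D suffice because
   the distance is integer-valued. *)

definition asdim_le :: "'a set \<Rightarrow> ('a \<Rightarrow> 'a \<Rightarrow> enat) \<Rightarrow> nat \<Rightarrow> bool" where
  "asdim_le X d n \<longleftrightarrow>
     (\<forall>R::nat. \<exists>(U :: nat \<Rightarrow> 'a set set) (D::nat).
        (\<Union>i\<le>n. \<Union>(U i)) = X \<and>
        (\<forall>i\<le>n. \<forall>A\<in>U i. \<forall>x\<in>A. \<forall>y\<in>A. d x y \<le> enat D) \<and>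
        (\<forall>i\<le>n. \<forall>A\<in>U i. \<forall>B\<in>U i. A \<noteq> B \<longrightarrow> (\<forall>x\<in>A. \<forall>y\<in>B. enat R < d x y)))"

definition asdim :: "'a set \<Rightarrow> ('a \<Rightarrow> 'a \<Rightarrow> enat) \<Rightarrow> enat" where
  "asdim X d = (INF n \<in> {n. asdim_le X d n}. enat n)"

(* Asymptotic dimension is a quasi-isometry invariant, so one could equivalently require this
   for a single finite generating set of a finitely generated group. *)

definition group_asdim_eq :: "('a, 'm) monoid_scheme \<Rightarrow> enat \<Rightarrow> bool" where
  "group_asdim_eq G k \<longleftrightarrow> finitely_generated_group G \<and>
     (\<forall>S. finite_generating_set G S \<longrightarrow> asdim (carrier G) (graph_dist (cayley_edges G S)) = k)"

end

theory Submission
  imports Defs "HOL-Analysis.Brouwer_Fixpoint" "HOL-Analysis.Function_Topology"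
begin

text \<open>
  The groups act on the points \<open>(j, z, w)\<close>: a coordinate \<open>j\<close>, a position \<open>z\<close> on a line and a
  state \<open>w\<close>.  The generator \<open>t\<close> translates all positions by one.  For \<open>j\<close> in a parameter set
  \<open>M\<close>, the generator \<open>a\<close> reflects the cyclic set of \<open>modulus j\<close> states at position \<open>0\<close>, and \<open>b\<close>
  reflects it about another centre at position \<open>sep j\<close>; in the coordinates outside \<open>M\<close> both act
  trivially.  The two reflections together generate a large dihedral group, but words that are
  short in comparison with \<open>sep j\<close> cannot bring them to the same position: for such words the
  lamps of coordinate \<open>j\<close> are merely commuting involutions.  This has two consequences.

  First, the conjugates of \<open>a\<close> and \<open>b\<close> by \<open>t\<close> to a power of size at most \<open>m\<close> generate a finite
  group.  If no \<open>j \<in> M\<close> with \<open>k \<le> j\<close> has \<open>sep j\<close> at most \<open>2 * m\<close>, then its order is bounded in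
  terms of the coordinates below \<open>k\<close> alone (\<open>lamp_subgroup_finite_card\<close>).  So the group is an
  extension of a locally finite group by the integers.  Such a group has almost invariant
  finite sets, hence is amenable (\<open>amenable\<close>), and it has asymptotic dimension one: cut it into
  blocks along the map to the integers and every block into translates of a finite subgroup
  (\<open>near_in_part\<close>, \<open>asdim_one\<close>).

  Second, if \<open>k \<in> M\<close>, then a word of length about \<open>2 * sep k\<close> brings the two reflections of
  coordinate \<open>k\<close> together; its square acts only there, because in all other coordinates it is
  the square of a product of commuting involutions (\<open>lamp_pair_square\<close>).  This rotation and
  its translate by \<open>t\<close> commute and span a square grid of side \<open>side k\<close>, on which neighbouring
  points have distance at most \<open>8 * sep k + 10\<close>.

  Suppose now that there is a regular map from the group of \<open>M\<close> to the group of \<open>M'\<close>, and let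
  \<open>k \<in> M - M'\<close> be large compared with its constant.  At the scale on which the map moves
  neighbouring grid points, the group of \<open>M'\<close> is cut into two families of pieces whose size is
  controlled by the coordinates below \<open>k\<close>, since \<open>k\<close> itself is absent and the higher coordinates
  are not visible yet.  The side of the grid is chosen larger than this in advance.  The preimages of the two
  families colour the grid with two colours such that every monochromatic component has fewer
  points than the side of the grid.  This contradicts a form of the Hex theorem
  (\<open>two_colouring_large_component\<close>), which is the statement that the plane does not have
  asymptotic dimension at most one.  It remains to choose a set of natural numbers for every real
  number such that all differences of two of them are infinite.
\<close>

section \<open>Word balls in Cayley graphs\<close>

text \<open>
  Balls about the identity in the Cayley graph.  Since distances are invariant under left
  multiplication, all metric statements below become statements about words
  (\<open>graph_dist_le_iff\<close>).  Admitting the identity as a letter makes the balls increasing.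
\<close>

primrec word_ball :: "('a, 'm) monoid_scheme \<Rightarrow> 'a set \<Rightarrow> nat \<Rightarrow> 'a set" where
  "word_ball G S 0 = {\<one>\<^bsub>G\<^esub>}"
| "word_ball G S (Suc n) = {g \<otimes>\<^bsub>G\<^esub> s | g s. g \<in> word_ball G S n \<and>
      (s = \<one>\<^bsub>G\<^esub> \<or> s \<in> S \<or> (\<exists>s'\<in>S. s = inv\<^bsub>G\<^esub> s'))}"

context group
begin

lemma word_ball_closed:
  assumes "S \<subseteq> carrier G"
  shows "word_ball G S n \<subseteq> carrier G"
  using assms by (induction n) auto

lemma word_ball_mono_Suc:
  assumes "S \<subseteq> carrier G"
  shows "word_ball G S n \<subseteq> word_ball G S (Suc n)"
proof
  fix g assume g: "g \<in> word_ball G S n"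
  then have "g \<otimes> \<one> \<in> word_ball G S (Suc n)" unfolding word_ball.simps by blast
  moreover have "g \<otimes> \<one> = g" using g word_ball_closed[OF assms, of n] by auto
  ultimately show "g \<in> word_ball G S (Suc n)" by simp
qed

lemma word_ball_mono:
  assumes "S \<subseteq> carrier G" "m \<le> n"
  shows "word_ball G S m \<subseteq> word_ball G S n"
  using assms(2) word_ball_mono_Suc[OF assms(1)] by (rule lift_Suc_mono_le[rotated])

lemma finite_word_ball:
  assumes "finite S"
  shows "finite (word_ball G S n)"
proof (induction n)
  case (Suc n)
  let ?L = "insert \<one> (S \<union> m_inv G ` S)"
  have "word_ball G S (Suc n) \<subseteq> (\<lambda>(g, s). g \<otimes> s) ` (word_ball G S n \<times> ?L)" by auto
  moreover have "finite (word_ball G S n \<times> ?L)" using Suc assms by simp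
  ultimately show ?case by (meson finite_imageI finite_subset)
qed simp

lemma word_ball_mult:
  assumes S: "S \<subseteq> carrier G" and g: "g \<in> word_ball G S m" and h: "h \<in> word_ball G S n"
  shows "g \<otimes> h \<in> word_ball G S (m + n)"
  using h
proof (induction n arbitrary: h)
  case 0
  then show ?case using g word_ball_closed[OF S, of m] by auto
next
  case (Suc n)
  then obtain h' s where h: "h = h' \<otimes> s" "h' \<in> word_ball G S n"
    and s: "s = \<one> \<or> s \<in> S \<or> (\<exists>s'\<in>S. s = inv s')" by auto
  have "s \<in> carrier G" "h' \<in> carrier G" "g \<in> carrier G"
    using s S h g word_ball_closed[OF S] by auto
  then have "g \<otimes> h = (g \<otimes> h') \<otimes> s" using h by (simp add: m_assoc)
  moreover have "g \<otimes> h' \<in> word_ball G S (m + n)" using Suc.IH h by blast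
  ultimately show ?case using s by auto
qed

lemma word_ball_1I:
  assumes "S \<subseteq> carrier G" "s \<in> S"
  shows "s \<in> word_ball G S 1" "inv s \<in> word_ball G S 1"
  using assms by (force intro: exI[of _ s] exI[of _ "inv s"])+

lemma word_ball_inv:
  assumes S: "S \<subseteq> carrier G" and "g \<in> word_ball G S n"
  shows "inv g \<in> word_ball G S n"
  using assms(2)
proof (induction n arbitrary: g)
  case (Suc n)
  then obtain h s where g: "g = h \<otimes> s" "h \<in> word_ball G S n"
    and s: "s = \<one> \<or> s \<in> S \<or> (\<exists>s'\<in>S. s = inv s')" by auto
  have c: "s \<in> carrier G" "h \<in> carrier G"
    using s S g word_ball_closed[OF S] by auto
  have "inv s \<in> word_ball G S 1"
  proof -
    consider "s = \<one>" | "s \<in> S" | s' where "s' \<in> S" "s = inv s'" using s by blast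
    then show ?thesis
    proof cases
      case 1
      then show ?thesis using word_ball_mono_Suc[OF S, of 0] by auto
    next
      case 2
      then show ?thesis using word_ball_1I[OF S] by blast
    next
      case 3
      then show ?thesis using word_ball_1I[OF S] S by (auto simp: subset_iff)
    qed
  qed
  then have "inv s \<otimes> inv h \<in> word_ball G S (1 + n)"
    using word_ball_mult[OF S] Suc.IH g(2) by blast
  then show ?case using g c by (simp add: inv_mult_group)
qed simp

lemma word_ball_pow:
  assumes S: "S \<subseteq> carrier G" and g: "g \<in> word_ball G S n"
  shows "g [^] (k::nat) \<in> word_ball G S (k * n)"
proof (induction k)
  case (Suc k)
  then show ?case using word_ball_mult[OF S Suc g] by (simp add: add.commute)
qed simp

lemma generate_subset_Union_word_ball:
  assumes S: "S \<subseteq> carrier G" and "g \<in> generate G S"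
  shows "\<exists>n. g \<in> word_ball G S n"
  using assms(2)
proof (induction rule: generate.induct)
  case one
  have "\<one> \<in> word_ball G S 0" by simp
  then show ?case by blast
next
  case (eng h1 h2)
  then show ?case using word_ball_mult[OF S] by blast
qed (use word_ball_1I[OF S] in blast)+

lemma finite_subset_word_ball:
  assumes S: "S \<subseteq> carrier G" "generate G S = carrier G" and "finite E" "E \<subseteq> carrier G"
  shows "\<exists>n. E \<subseteq> word_ball G S n"
  using assms(3,4)
proof (induction rule: finite_induct)
  case (insert x E)
  then obtain n m where "E \<subseteq> word_ball G S n" "x \<in> word_ball G S m"
    using generate_subset_Union_word_ball[OF S(1)] S(2) by blast
  then have "insert x E \<subseteq> word_ball G S (max n m)"
    using word_ball_mono[OF S(1), of n "max n m"] word_ball_mono[OF S(1), of m "max n m"] by auto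
  then show ?case by blast
qed simp

text \<open>
  Passing from one generating set to another costs a constant factor; this is how arbitrary
  generating sets are reduced to the standard one.
\<close>

lemma word_ball_rescale:
  assumes S: "S \<subseteq> carrier G" and T: "T \<subseteq> word_ball G S c"
  shows "word_ball G T n \<subseteq> word_ball G S (n * c)"
proof (induction n)
  case (Suc n)
  show ?case
  proof
    fix g assume "g \<in> word_ball G T (Suc n)"
    then obtain h s where g: "g = h \<otimes> s" "h \<in> word_ball G T n"
      and s: "s = \<one> \<or> s \<in> T \<or> (\<exists>s'\<in>T. s = inv s')" by auto
    have "\<one> \<in> word_ball G S c" using word_ball_mono[OF S, of 0 c] by auto
    then have "s \<in> word_ball G S c"
      using s T word_ball_inv[OF S] by auto
    then have "h \<otimes> s \<in> word_ball G S (n * c + c)"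
      using Suc g(2) word_ball_mult[OF S] by blast
    then show "g \<in> word_ball G S (Suc n * c)" using g(1) by (simp add: add.commute)
  qed
qed simp

lemma cayley_path_imp_word_ball:
  assumes S: "S \<subseteq> carrier G" and "(x, y) \<in> cayley_edges G S ^^ n" "x \<in> carrier G"
  shows "y \<in> carrier G \<and> inv x \<otimes> y \<in> word_ball G S n"
  using assms(2)
proof (induction n arbitrary: y)
  case 0
  then show ?case using assms(3) by simp
next
  case (Suc n)
  then obtain z where "(x, z) \<in> cayley_edges G S ^^ n" and e: "(z, y) \<in> cayley_edges G S" by auto
  then have z: "z \<in> carrier G" "inv x \<otimes> z \<in> word_ball G S n" using Suc.IH by auto
  from e obtain s where s: "s \<in> S" "y = z \<otimes> s \<or> z = y \<otimes> s" and y: "y \<in> carrier G"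
    by (auto simp: cayley_edges_def)
  have sc: "s \<in> carrier G" using s S by blast
  obtain s' where s': "s' = s \<or> s' = inv s" "y = z \<otimes> s'"
    using s y z(1) sc by (metis inv_closed inv_solve_right)
  then have "inv x \<otimes> y = (inv x \<otimes> z) \<otimes> s'" using z(1) sc assms(3) by (auto simp: m_assoc)
  moreover have "s' \<in> S \<or> (\<exists>s''\<in>S. s' = inv s'')" using s s' by auto
  ultimately show ?case using y z(2) by auto
qed

lemma word_ball_imp_cayley_path:
  assumes S: "S \<subseteq> carrier G" and "g \<in> word_ball G S n" "x \<in> carrier G"
  shows "\<exists>m\<le>n. (x, x \<otimes> g) \<in> cayley_edges G S ^^ m"
  using assms(2)
proof (induction n arbitrary: g)
  case 0
  then show ?case using assms(3) by auto
next
  case (Suc n)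
  then obtain h s where g: "g = h \<otimes> s" "h \<in> word_ball G S n"
    and s: "s = \<one> \<or> s \<in> S \<or> (\<exists>s'\<in>S. s = inv s')" by auto
  have c: "s \<in> carrier G" "h \<in> carrier G"
    using s S g word_ball_closed[OF S] by auto
  obtain m where m: "m \<le> n" "(x, x \<otimes> h) \<in> cayley_edges G S ^^ m" using Suc.IH g(2) by blast
  show ?case
  proof (cases "s = \<one>")
    case True
    then show ?thesis using m g c by (auto intro!: exI[of _ m])
  next
    case False
    have xg: "x \<otimes> g = (x \<otimes> h) \<otimes> s" using g c assms(3) by (simp add: m_assoc)
    from False s obtain s' where s': "s' \<in> S" "s = s' \<or> s = inv s'" by auto
    then have "s' \<in> carrier G" using S by auto
    then have "x \<otimes> g = (x \<otimes> h) \<otimes> s' \<or> x \<otimes> h = (x \<otimes> g) \<otimes> s'"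
      using s'(2) xg c assms(3) by (auto simp: m_assoc)
    then have "(x \<otimes> h, x \<otimes> g) \<in> cayley_edges G S"
      using s'(1) c assms(3) g(1) by (auto simp: cayley_edges_def)
    then have "(x, x \<otimes> g) \<in> cayley_edges G S ^^ Suc m" using m(2) by auto
    then show ?thesis using m(1) by (meson Suc_le_mono)
  qed
qed

lemma graph_dist_le_iff:
  assumes S: "S \<subseteq> carrier G" and "x \<in> carrier G" "y \<in> carrier G"
  shows "graph_dist (cayley_edges G S) x y \<le> enat n \<longleftrightarrow> inv x \<otimes> y \<in> word_ball G S n"
proof
  assume "inv x \<otimes> y \<in> word_ball G S n"
  from word_ball_imp_cayley_path[OF S this assms(2)]
  obtain m where "m \<le> n" "(x, y) \<in> cayley_edges G S ^^ m"
    using assms by (auto simp: m_assoc[symmetric])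
  then show "graph_dist (cayley_edges G S) x y \<le> enat n"
    unfolding graph_dist_def by (meson INF_lower2 enat_ord_simps(1) mem_Collect_eq)
next
  let ?N = "{n. (x, y) \<in> cayley_edges G S ^^ n}"
  assume le: "graph_dist (cayley_edges G S) x y \<le> enat n"
  have "?N \<noteq> {}"
  proof
    assume "?N = {}"
    then have "graph_dist (cayley_edges G S) x y = \<infinity>"
      unfolding graph_dist_def by (simp add: top_enat_def)
    then show False using le by simp
  qed
  then have "(INF n\<in>?N. enat n) \<in> enat ` ?N" by (metis Inf_enat_def LeastI empty_iff ex_in_conv image_is_empty)
  then obtain m where m: "m \<in> ?N" "(INF n\<in>?N. enat n) = enat m" by blast
  then have "m \<le> n" using le by (simp add: graph_dist_def)
  then show "inv x \<otimes> y \<in> word_ball G S n"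
    using cayley_path_imp_word_ball[OF S, of x y m] m(1) assms(2) word_ball_mono[OF S, of m n] by blast
qed

end

section \<open>Two-colourings of the square grid\<close>

text \<open>
  Two cells of the grid with side \<open>p\<close> are joined if they have the same colour and a king gets
  from one to the other in at most one move.  Diagonal moves are included so that the cells of
  one simplex in Kuhn's triangulation are pairwise adjacent.
\<close>

definition king_step :: "nat \<Rightarrow> (nat \<times> nat \<Rightarrow> bool) \<Rightarrow> ((nat \<times> nat) \<times> (nat \<times> nat)) set" where
  "king_step p c = {(u, v). fst u \<le> p \<and> snd u \<le> p \<and> fst v \<le> p \<and> snd v \<le> p \<and>
     fst u \<le> fst v + 1 \<and> fst v \<le> fst u + 1 \<and> snd u \<le> snd v + 1 \<and> snd v \<le> snd u + 1 \<and> c u = c v}"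

lemma sym_king_step: "sym (king_step p c)"
  by (auto simp: king_step_def sym_def)

lemma king_path_intermediate:
  fixes f :: "nat \<times> nat \<Rightarrow> nat"
  assumes "(u, v) \<in> (king_step p c)\<^sup>*"
    and f: "\<And>x y. (x, y) \<in> king_step p c \<Longrightarrow> f y \<le> f x + 1"
    and "f u \<le> a" "a \<le> f v"
  shows "\<exists>w. (u, w) \<in> (king_step p c)\<^sup>* \<and> f w = a"
  using assms(1,3,4)
proof (induction rule: rtrancl_induct)
  case base
  then have "f u = a" by simp
  then show ?case by blast
next
  case (step y z)
  show ?case
  proof (cases "a \<le> f y")
    case True
    then show ?thesis using step by blast
  next
    case False
    with f[OF step(2)] step.prems have "a = f z" by linarith
    moreover have "(u, z) \<in> (king_step p c)\<^sup>*" using step(1,2) by simp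
    ultimately show ?thesis by blast
  qed
qed

lemma king_path_in_grid:
  assumes "(u, v) \<in> (king_step p c)\<^sup>*" "fst u \<le> p" "snd u \<le> p"
  shows "fst v \<le> p \<and> snd v \<le> p"
  using assms by (induction rule: rtrancl_induct) (auto simp: king_step_def)

lemma crossing_component_large:
  fixes f :: "nat \<times> nat \<Rightarrow> nat"
  assumes uv: "(u, v) \<in> (king_step p c)\<^sup>*" and "fst u \<le> p" "snd u \<le> p"
    and f: "\<And>x y. (x, y) \<in> king_step p c \<Longrightarrow> f y \<le> f x + 1"
    and "f u = 0" "f v = p"
  shows "p < card ((king_step p c)\<^sup>* `` {u})"
proof -
  let ?C = "(king_step p c)\<^sup>* `` {u}"
  have "?C \<subseteq> {..p} \<times> {..p}"
    using king_path_in_grid[of u _ p c] assms(2,3) by (auto simp: mem_Times_iff)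
  then have fin: "finite ?C" by (meson finite_SigmaI finite_atMost finite_subset)
  have "{..p} \<subseteq> f ` ?C"
  proof
    fix a assume "a \<in> {..p}"
    then show "a \<in> f ` ?C"
      using king_path_intermediate[where f = f and a = a, OF uv f] assms(5,6) by force
  qed
  then have "card {..p} \<le> card (f ` ?C)" using fin by (intro card_mono) auto
  also have "\<dots> \<le> card ?C" using fin by (rule card_image_le)
  finally show ?thesis by simp
qed

text \<open>
  If all components had at most \<open>p\<close> points, then none would join two opposite sides.  Label a
  cell in each of the two directions by whether its component meets the side where that
  coordinate vanishes.  These labels satisfy the boundary conditions of Kuhn's combinatorial
  lemma, so some triangle carries all three reduced labels.  The labels are constant on
  components, so the three cells lie in three different components; but the cells are pairwise
  adjacent and there are only two colours.
\<close>

theorem two_colouring_large_component: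
  assumes "0 < p"
  shows "\<exists>u. fst u \<le> p \<and> snd u \<le> p \<and> p < card ((king_step p c)\<^sup>* `` {u})"
proof (rule ccontr)
  assume small: "\<not> ?thesis"
  let ?E = "(king_step p c)\<^sup>*"
  define pt :: "(nat \<Rightarrow> nat) \<Rightarrow> nat \<times> nat" where "pt x = (x 0, x 1)" for x
  define pr :: "nat \<Rightarrow> nat \<times> nat \<Rightarrow> nat" where "pr i u = (if i = 0 then fst u else snd u)" for i u
  define lab :: "(nat \<Rightarrow> nat) \<Rightarrow> nat \<Rightarrow> nat" where
    "lab x i = (if \<exists>u. (pt x, u) \<in> ?E \<and> pr i u = 0 then 0 else 1)" for x i
  have symE: "(u, v) \<in> ?E \<Longrightarrow> (v, u) \<in> ?E" for u v
    using sym_king_step by (metis sym_def sym_rtrancl)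
  have lab0: "lab x i = 0" if "i < 2" "x i = 0" for x i
    unfolding lab_def using that by (auto simp: pt_def pr_def less_2_cases_iff intro!: exI[of _ "pt x"])
  have lab1: "lab x i = 1" if "\<forall>j. x j \<le> p" "i < 2" "x i = p" for x i
  proof (rule ccontr)
    assume "lab x i \<noteq> 1"
    then obtain u where u: "(pt x, u) \<in> ?E" "pr i u = 0" by (auto simp: lab_def split: if_splits)
    have "fst u \<le> p" "snd u \<le> p" using king_path_in_grid[OF u(1)] that by (auto simp: pt_def)
    moreover have "pr i (pt x) = p" using that by (auto simp: pr_def pt_def less_2_cases_iff)
    moreover have "pr i y \<le> pr i x + 1" if "(x, y) \<in> king_step p c" for x y
      using that by (auto simp: pr_def king_step_def)
    ultimately have "p < card (?E `` {u})"
      using crossing_component_large[OF symE[OF u(1)], of "pr i"] u(2) by blast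
    then show False using small \<open>fst u \<le> p\<close> \<open>snd u \<le> p\<close> by blast
  qed
  have "odd (card {s. ksimplex p 2 s \<and> (reduced 2 \<circ> lab) ` s = {..2}})"
    using assms lab0 lab1 by (intro kuhn_combinatorial) auto
  then have "{s. ksimplex p 2 s \<and> (reduced 2 \<circ> lab) ` s = {..2}} \<noteq> {}"
    by (metis card.empty even_zero)
  then obtain s where s: "ksimplex p 2 s" "(reduced 2 \<circ> lab) ` s = {..2}" by blast
  from s(1) obtain base upd where ks: "kuhn_simplex p 2 base upd s" by (auto elim: ksimplex.cases)
  interpret kuhn_simplex p 2 base upd s by fact
  have grid: "x i \<le> p" if "x \<in> s" for x i
    using s_le_p[OF that] by auto
  have close: "x i \<le> y i + 1" if "x \<in> s" "y \<in> s" for x y i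
    using that unfolding s_pre by (auto split: if_splits)
  have same: "(pt x, pt y) \<in> ?E" if "x \<in> s" "y \<in> s" "c (pt x) = c (pt y)" for x y
    using that grid close by (intro r_into_rtrancl) (auto simp: king_step_def pt_def)
  have red_eq: "reduced 2 (lab x) = reduced 2 (lab y)" if "x \<in> s" "y \<in> s" "c (pt x) = c (pt y)" for x y
  proof -
    have "(pt x, u) \<in> ?E \<longleftrightarrow> (pt y, u) \<in> ?E" for u
      using same[OF that] symE by (meson rtrancl_trans)
    then have "lab x = lab y" unfolding lab_def by auto
    then show ?thesis by simp
  qed
  have "\<exists>x\<in>s. reduced 2 (lab x) = i" if "i \<le> 2" for i
  proof -
    have "i \<in> (reduced 2 \<circ> lab) ` s" using s(2) that by simp
    then show ?thesis by auto
  qed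
  from this[of 0] this[of 1] this[of 2] obtain x y z where
    "x \<in> s" "y \<in> s" "z \<in> s" "reduced 2 (lab x) = 0" "reduced 2 (lab y) = 1" "reduced 2 (lab z) = 2"
    by auto
  then show False using red_eq by (metis one_neq_zero zero_neq_numeral numeral_eq_one_iff semiring_norm(85))
qed

section \<open>Locally finite extensions of the integers are amenable\<close>

text \<open>
  Counting in an almost invariant finite set gives a finitely additive measure which is almost
  invariant under finitely many elements.  By Tychonoff's theorem the functions from sets to the
  unit interval form a compact space, and each requirement on the measure is closed, so measures
  for finitely many requirements yield one for all of them.
\<close>

lemma (in group) amenable_if_almost_invariant_sets:
  assumes folner: "\<And>E \<epsilon>. finite E \<Longrightarrow> E \<subseteq> carrier G \<Longrightarrow> 0 < \<epsilon> \<Longrightarrow>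
    \<exists>F. finite F \<and> F \<noteq> {} \<and> F \<subseteq> carrier G \<and>
      (\<forall>g\<in>E. real (card ((g <# F) - F)) \<le> \<epsilon> * real (card F))"
  shows "amenable_group G"
proof -
  let ?K = "Pi UNIV (\<lambda>_. {0..1}) :: ('a set \<Rightarrow> real) set"
  define C where "C g \<epsilon> = {m :: 'a set \<Rightarrow> real. m (carrier G) = 1 \<and>
     (\<forall>A B. A \<subseteq> carrier G \<longrightarrow> B \<subseteq> carrier G \<longrightarrow> A \<inter> B = {} \<longrightarrow> m (A \<union> B) = m A + m B) \<and>
     (\<forall>A. A \<subseteq> carrier G \<longrightarrow> m A \<le> m (g <# A) + \<epsilon>)}" for g \<epsilon>
  let ?I = "carrier G \<times> {0<..} :: ('a \<times> real) set"
  have "compactin (product_topology (\<lambda>_. euclidean) UNIV) ?K"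
    using compactin_PiE[of "\<lambda>_. euclidean" UNIV "\<lambda>_::'a set. {0..1::real}"]
    by (simp add: PiE_def)
  then have "compact ?K" by (simp add: euclidean_product_topology)
  then have "?K \<inter> (\<Inter>i\<in>?I. C (fst i) (snd i)) \<noteq> {}"
  proof (rule compact_imp_fip_image)
    fix i :: "'a \<times> real" assume "i \<in> ?I"
    show "closed (C (fst i) (snd i))" unfolding C_def
      by (intro closed_Collect_conj closed_Collect_all closed_Collect_imp closed_Collect_eq
          closed_Collect_le continuous_intros continuous_on_product_coordinates open_Collect_const)
  next
    fix I' assume I': "finite I'" "I' \<subseteq> ?I"
    \<comment> \<open>one set that is good enough for the smallest of the finitely many tolerances\<close>
    define \<epsilon> where "\<epsilon> = Min (insert 1 (snd ` I'))"
    have fin: "finite (insert 1 (snd ` I'))" using I' by simp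
    have I'_elem: "g \<in> carrier G \<and> 0 < e" if "(g, e) \<in> I'" for g e
      using subsetD[OF I'(2) that] by simp
    have \<epsilon>: "0 < \<epsilon>"
      unfolding \<epsilon>_def Min_gr_iff[OF fin insert_not_empty] using I'_elem by fastforce
    have \<epsilon>_le: "\<epsilon> \<le> e" if "(g, e) \<in> I'" for g e
      unfolding \<epsilon>_def using that by (intro Min_le[OF fin]) force
    have fst_fin: "finite (fst ` I')" using I'(1) by simp
    have fst_sub: "fst ` I' \<subseteq> carrier G" using I'_elem by fastforce
    obtain F where F: "finite F" "F \<noteq> {}" "F \<subseteq> carrier G"
      and inv: "\<And>g. g \<in> fst ` I' \<Longrightarrow> real (card ((g <# F) - F)) \<le> \<epsilon> * real (card F)"
      using folner[OF fst_fin fst_sub \<epsilon>] by (elim exE conjE) (rule that, auto)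
    have F0: "0 < real (card F)" using F by (simp add: card_gt_0_iff)
    define m where "m A = real (card (A \<inter> F)) / real (card F)" for A
    have "m \<in> ?K" using F F0 by (auto simp: m_def divide_le_eq intro!: card_mono)
    moreover have "m \<in> C g e" if ge: "(g, e) \<in> I'" for g e
    proof -
      have g: "g \<in> carrier G" using I'_elem[OF ge] by simp
      have "m (carrier G) = 1" using F F0 by (simp add: m_def Int_absorb1)
      moreover have "m (A \<union> B) = m A + m B" if "A \<inter> B = {}" for A B
      proof -
        have "card ((A \<union> B) \<inter> F) = card (A \<inter> F) + card (B \<inter> F)"
          unfolding Int_Un_distrib2 using that F by (intro card_Un_disjoint) auto
        then show ?thesis by (simp add: m_def add_divide_distrib)
      qed
      moreover have "m A \<le> m (g <# A) + e" if A: "A \<subseteq> carrier G" for A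
      proof -
        have "(\<lambda>x. g \<otimes> x) ` (A \<inter> F) \<subseteq> ((g <# A) \<inter> F) \<union> ((g <# F) - F)"
          by (auto simp: l_coset_def)
        moreover have fin: "finite (g <# F)" using F by (simp add: l_coset_def)
        ultimately have "card ((\<lambda>x. g \<otimes> x) ` (A \<inter> F)) \<le> card (((g <# A) \<inter> F) \<union> ((g <# F) - F))"
          using F by (intro card_mono) auto
        moreover have "card ((\<lambda>x. g \<otimes> x) ` (A \<inter> F)) = card (A \<inter> F)"
          using A g F by (intro card_image inj_onI) (auto simp: subset_iff)
        moreover have "card (((g <# A) \<inter> F) \<union> ((g <# F) - F))
            \<le> card ((g <# A) \<inter> F) + card ((g <# F) - F)"
          by (rule card_Un_le)
        ultimately have "real (card (A \<inter> F)) \<le> real (card ((g <# A) \<inter> F)) + real (card ((g <# F) - F))"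
          by linarith
        also have "real (card ((g <# F) - F)) \<le> \<epsilon> * real (card F)" using inv ge by force
        also have "\<epsilon> * real (card F) \<le> e * real (card F)" using \<epsilon>_le[OF ge] by (simp add: mult_right_mono)
        finally show ?thesis using F0 by (simp add: m_def field_simps)
      qed
      ultimately show ?thesis by (simp add: C_def)
    qed
    ultimately have "m \<in> ?K \<inter> (\<Inter>i\<in>I'. C (fst i) (snd i))" by simp
    then show "?K \<inter> (\<Inter>i\<in>I'. C (fst i) (snd i)) \<noteq> {}" by blast
  qed
  then obtain m where mI: "m \<in> ?K \<inter> (\<Inter>i\<in>?I. C (fst i) (snd i))" unfolding ex_in_conv[symmetric] ..
  have mK: "m \<in> ?K" using mI by (rule IntD1)
  have "m \<in> C g e" if "g \<in> carrier G" "0 < e" for g e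
  proof -
    have "\<forall>i\<in>?I. m \<in> C (fst i) (snd i)" using IntD2[OF mI] by (simp only: INT_iff)
    from bspec[OF this, of "(g, e)"] show ?thesis using that by (simp only: fst_conv snd_conv mem_Times_iff greaterThan_iff)
  qed
  note m = this[unfolded C_def mem_Collect_eq]
  have le: "m A \<le> m (g <# A)" if "g \<in> carrier G" "A \<subseteq> carrier G" for g A
  proof (rule field_le_epsilon)
    fix e :: real assume "0 < e"
    from m[OF that(1) this] show "m A \<le> m (g <# A) + e" using that(2) by simp
  qed
  have eq: "m (g <# A) = m A" if g: "g \<in> carrier G" and A: "A \<subseteq> carrier G" for g A
  proof (rule antisym)
    have gA: "g <# A \<subseteq> carrier G" using l_coset_subset_G[OF A g] .
    have "inv g <# (g <# A) = A" using g A by (simp add: lcos_m_assoc lcos_mult_one)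
    then show "m (g <# A) \<le> m A" using le[of "inv g" "g <# A"] g gA by simp
  qed (rule le[OF g A])
  show ?thesis unfolding amenable_group_def
  proof (intro conjI exI[of _ m] ballI allI impI)
    show "group G" by (rule is_group)
    show "m (carrier G) = 1" using m[of \<one> 1] by simp
    show "m (A \<union> B) = m A + m B" if "A \<subseteq> carrier G" "B \<subseteq> carrier G" "A \<inter> B = {}" for A B
      using m[of \<one> 1] that by simp
    show "0 \<le> m A" for A using mK by auto
    show "m (g <# A) = m A" if "g \<in> carrier G" "A \<subseteq> carrier G" for g A using eq that .
  qed
qed

text \<open>
  An extension of a locally finite group, the kernel of \<open>h\<close>, by the integers; the element \<open>t\<close>
  splits it.
\<close>

locale locally_finite_by_int = group +
  fixes h :: "'a \<Rightarrow> int" and t :: 'a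
  assumes h_mult: "x \<in> carrier G \<Longrightarrow> y \<in> carrier G \<Longrightarrow> h (x \<otimes> y) = h x + h y"
    and t_closed [simp]: "t \<in> carrier G"
    and h_t: "h t = 1"
    and locally_finite: "finite E \<Longrightarrow> E \<subseteq> carrier G \<Longrightarrow> (\<And>e. e \<in> E \<Longrightarrow> h e = 0) \<Longrightarrow>
      finite (generate G E)"
begin

lemma h_one: "h \<one> = 0"
  using h_mult[of \<one> \<one>] by simp

lemma h_inv: "x \<in> carrier G \<Longrightarrow> h (inv x) = - h x"
  using h_mult[of x "inv x"] h_one by simp

lemma h_pow: "x \<in> carrier G \<Longrightarrow> h (x [^] (n::nat)) = int n * h x"
  by (induction n) (auto simp: h_one h_mult algebra_simps)

lemma h_t_pow: "h (t [^] (i::int)) = i"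
proof (cases i rule: int_cases2)
  case (nonneg n)
  then show ?thesis using h_pow[of t n] by (simp add: int_pow_int h_t)
next
  case (nonpos n)
  then show ?thesis using h_pow[of t n] by (simp add: int_pow_neg int_pow_int h_t h_inv)
qed

lemma h_generate_zero:
  assumes "E \<subseteq> carrier G" "\<And>e. e \<in> E \<Longrightarrow> h e = 0" "x \<in> generate G E"
  shows "h x = 0"
  using assms(3)
proof (induction rule: generate.induct)
  case (eng h1 h2)
  then show ?case using generate_in_carrier[OF assms(1)] by (simp add: h_mult)
qed (use assms in \<open>auto simp: h_one h_inv subset_iff\<close>)

lemma t_pow_inv_cancel [simp]:
  "x \<in> carrier G \<Longrightarrow> t [^] (i::int) \<otimes> (t [^] (- i) \<otimes> x) = x"
  "x \<in> carrier G \<Longrightarrow> t [^] (- i) \<otimes> (t [^] (i::int) \<otimes> x) = x"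
  by (simp_all add: int_pow_neg flip: m_assoc)

text \<open>
  The almost invariant sets are \<open>{t^i k | 0 \<le> i < n, k \<in> H}\<close> with a finite subgroup \<open>H\<close> of the
  kernel.  If \<open>H\<close> absorbs the corrections \<open>t^-(h e + i) e t^i\<close>, then multiplication by \<open>e\<close> merely
  moves the exponent by \<open>h e\<close>, so that only a proportion \<open>\<bar>h e\<bar> / n\<close> of the set leaves it.
\<close>

theorem amenable: "amenable_group G"
proof (rule amenable_if_almost_invariant_sets)
  fix E :: "'a set" and \<epsilon> :: real
  assume E: "finite E" "E \<subseteq> carrier G" and \<epsilon>: "0 < \<epsilon>"
  define b where "b = Max (insert 0 ((\<lambda>e. \<bar>h e\<bar>) ` E))"
  have b: "0 \<le> b" "\<And>e. e \<in> E \<Longrightarrow> \<bar>h e\<bar> \<le> b"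
    using E unfolding b_def by (auto intro!: Max_ge)
  obtain n :: nat where n: "real_of_int b / \<epsilon> < real n" using reals_Archimedean2 by blast
  have n0: "0 < n" using n b(1) \<epsilon> by (metis divide_nonneg_pos gr0I of_int_0_le_iff of_nat_0 not_less)
  define P where "P = (\<lambda>(e, i). t [^] (- (h e + i)) \<otimes> e \<otimes> t [^] i) ` (E \<times> {0..<int n})"
  have P: "finite P" "P \<subseteq> carrier G" "\<And>p. p \<in> P \<Longrightarrow> h p = 0"
    using E by (auto simp: P_def h_mult h_t_pow subset_iff)
  define H where "H = generate G P"
  have H: "subgroup H G" "finite H"
    unfolding H_def using generate_is_subgroup[OF P(2)] locally_finite[OF P] by auto
  have Hc: "H \<subseteq> carrier G" "\<one> \<in> H"
    using H(1) subgroup.subset subgroup.one_closed by blast+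
  have hH: "h k = 0" if "k \<in> H" for k
    using h_generate_zero[OF P(2,3)] that unfolding H_def by blast
  define F where "F = (\<lambda>(i, k). t [^] i \<otimes> k) ` ({0..<int n} \<times> H)"
  have inj: "inj_on (\<lambda>(i::int, k). t [^] i \<otimes> k) (UNIV \<times> H)"
  proof (rule inj_onI)
    fix x y :: "int \<times> 'a"
    assume xy: "x \<in> UNIV \<times> H" "y \<in> UNIV \<times> H" "(\<lambda>(i, k). t [^] i \<otimes> k) x = (\<lambda>(i, k). t [^] i \<otimes> k) y"
    obtain i k j l where x: "x = (i, k)" and y: "y = (j, l)" by fastforce
    have kl: "k \<in> H" "l \<in> H" "t [^] i \<otimes> k = t [^] j \<otimes> l" using xy x y by auto
    then have c: "k \<in> carrier G" "l \<in> carrier G" using Hc by auto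
    have "h (t [^] i \<otimes> k) = i" "h (t [^] j \<otimes> l) = j" using c kl(1,2) by (simp_all add: h_mult h_t_pow hH)
    then have "i = j" using kl(3) by simp
    then show "x = y" using x y kl(3) c by simp
  qed
  have "card F = card ({0..<int n} \<times> H)"
    unfolding F_def by (rule card_image) (rule inj_on_subset[OF inj], blast)
  then have cardF: "card F = n * card H" by (simp add: card_cartesian_product)
  then have "F \<noteq> {}" using n0 H(2) Hc(2) by (metis card_0_eq card.empty empty_iff mult_is_0 not_gr0)
  moreover have "finite F" using H(2) by (simp add: F_def)
  moreover have "F \<subseteq> carrier G" using Hc(1) by (auto simp: F_def)
  ultimately have F: "finite F" "F \<noteq> {}" "F \<subseteq> carrier G" by auto
  have "real (card ((g <# F) - F)) \<le> \<epsilon> * real (card F)" if g: "g \<in> E" for g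
  proof -
    have gc: "g \<in> carrier G" using g E by blast
    define J where "J = {h g..<h g + int n} - {0..<int n}"
    have "J \<subseteq> {h g..<0} \<union> {int n..<int n + h g}" by (auto simp: J_def)
    then have "card J \<le> card ({h g..<0} \<union> {int n..<int n + h g})" by (intro card_mono) auto
    also have "\<dots> \<le> card {h g..<0} + card {int n..<int n + h g}" by (rule card_Un_le)
    finally have cardJ: "int (card J) \<le> b" using b(2)[OF g] b(1) by auto
    have "(g <# F) - F \<subseteq> (\<lambda>(i, k). t [^] i \<otimes> k) ` (J \<times> H)"
    proof
      fix x assume x: "x \<in> (g <# F) - F"
      then obtain i k where i: "i \<in> {0..<int n}" and k: "k \<in> H" and xg: "x = g \<otimes> (t [^] i \<otimes> k)"
        by (auto simp: l_coset_def F_def)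
      let ?p = "t [^] (- (h g + i)) \<otimes> g \<otimes> t [^] i"
      have kc: "k \<in> carrier G" using k Hc by blast
      have "?p \<in> P" unfolding P_def using g i by (intro image_eqI[of _ _ "(g, i)"]) auto
      then have "?p \<in> H" unfolding H_def by (rule generate.incl)
      then have pk: "?p \<otimes> k \<in> H" using k H(1) by (simp add: subgroup.m_closed)
      have xp: "x = t [^] (h g + i) \<otimes> (?p \<otimes> k)"
      proof -
        have "t [^] j \<otimes> (t [^] (- j) \<otimes> g \<otimes> t [^] i \<otimes> k) = g \<otimes> (t [^] i \<otimes> k)" for j :: int
          using gc kc by (simp add: m_assoc)
        from this[of "h g + i"] show ?thesis unfolding xg by (rule sym)
      qed
      have xim: "x \<in> (\<lambda>(i, k). t [^] i \<otimes> k) ` (I \<times> H)" if "h g + i \<in> I" for I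
        proof (rule image_eqI)
        show "(h g + i, ?p \<otimes> k) \<in> I \<times> H" using that pk by simp
        show "x = (case (h g + i, ?p \<otimes> k) of (i, k) \<Rightarrow> t [^] i \<otimes> k)" using xp by (simp only: prod.case)
      qed
      then have "h g + i \<notin> {0..<int n}" using x unfolding F_def by blast
      then have "h g + i \<in> J" using i by (simp add: J_def)
      then show "x \<in> (\<lambda>(i, k). t [^] i \<otimes> k) ` (J \<times> H)" by (rule xim)
    qed
    moreover have fin: "finite (J \<times> H)" using H(2) by (simp add: J_def)
    ultimately have "card ((g <# F) - F) \<le> card ((\<lambda>(i, k). t [^] i \<otimes> k) ` (J \<times> H))"
      by (intro card_mono) simp_all
    also have "\<dots> \<le> card (J \<times> H)" using fin by (rule card_image_le)
    finally have "card ((g <# F) - F) \<le> card J * card H" by (simp add: card_cartesian_product)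
    then have "real (card ((g <# F) - F)) \<le> real (card J) * real (card H)"
      by (metis of_nat_le_iff of_nat_mult)
    also have "\<dots> \<le> real_of_int b * real (card H)"
      using cardJ by (intro mult_right_mono) linarith+
    also have "\<dots> \<le> (\<epsilon> * real n) * real (card H)"
    proof (rule mult_right_mono)
      show "real_of_int b \<le> \<epsilon> * real n" using n \<epsilon> by (simp add: pos_divide_less_eq mult.commute)
    qed simp
    finally show ?thesis unfolding cardF of_nat_mult mult.assoc .
  qed
  then show "\<exists>F. finite F \<and> F \<noteq> {} \<and> F \<subseteq> carrier G \<and>
      (\<forall>g\<in>E. real (card ((g <# F) - F)) \<le> \<epsilon> * real (card F))"
    using F by blast
qed

subsection \<open>Cutting the group into blocks\<close>

text \<open>
  The group is cut into blocks on which \<open>h x div W\<close> is constant.  Every element is moved to the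
  lower end of its block by a power of \<open>t\<close>; two elements of a block belong to the same piece if
  the resulting elements lie in the same left coset of a subgroup \<open>K\<close> of the kernel.
\<close>

definition base :: "int \<Rightarrow> 'a \<Rightarrow> 'a" where
  "base W x = x \<otimes> t [^] (- (h x mod W))"

definition part :: "int \<Rightarrow> 'a set \<Rightarrow> 'a \<Rightarrow> 'a set" where
  "part W K x = {y \<in> carrier G. h y div W = h x div W \<and> inv (base W x) \<otimes> base W y \<in> K}"

lemma base_closed [simp]: "x \<in> carrier G \<Longrightarrow> base W x \<in> carrier G"
  by (simp add: base_def)

lemma part_self:
  assumes "subgroup K G" "x \<in> carrier G"
  shows "x \<in> part W K x"
  using assms by (simp add: part_def subgroup.one_closed)

lemma part_eq:
  assumes K: "subgroup K G" and x: "x \<in> carrier G" and y: "y \<in> part W K x"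
  shows "part W K y = part W K x"
proof -
  have yc: "y \<in> carrier G" and hy: "h y div W = h x div W"
    and k: "inv (base W x) \<otimes> base W y \<in> K" using y by (auto simp: part_def)
  have "inv (inv (base W x) \<otimes> base W y) \<in> K" using K k by (rule subgroup.m_inv_closed)
  then have k': "inv (base W y) \<otimes> base W x \<in> K" using x yc by (simp add: inv_mult_group)
  have cancel: "a \<otimes> (inv a \<otimes> b) = b" if "a \<in> carrier G" "b \<in> carrier G" for a b
    using that by (simp flip: m_assoc)
  have "inv (base W y) \<otimes> base W z \<in> K \<longleftrightarrow> inv (base W x) \<otimes> base W z \<in> K" if z: "z \<in> carrier G" for z
  proof
    assume "inv (base W y) \<otimes> base W z \<in> K"
    with k have "(inv (base W x) \<otimes> base W y) \<otimes> (inv (base W y) \<otimes> base W z) \<in> K"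
      by (rule subgroup.m_closed[OF K])
    then show "inv (base W x) \<otimes> base W z \<in> K"
      using x yc z by (simp add: m_assoc cancel)
  next
    assume "inv (base W x) \<otimes> base W z \<in> K"
    with k' have "(inv (base W y) \<otimes> base W x) \<otimes> (inv (base W x) \<otimes> base W z) \<in> K"
      by (rule subgroup.m_closed[OF K])
    then show "inv (base W y) \<otimes> base W z \<in> K"
      using x yc z by (simp add: m_assoc cancel)
  qed
  then show ?thesis using hy by (auto simp: part_def)
qed

lemma part_elem:
  assumes W: "0 < W" and "y \<in> part W K x"
  shows "\<exists>k\<in>K. \<exists>q\<in>{0..<W}. inv (base W x) \<otimes> base W y = k \<and> y = base W y \<otimes> t [^] q"
proof -
  have "y = base W y \<otimes> t [^] (h y mod W)"
    using assms(2) by (simp add: part_def base_def m_assoc int_pow_neg)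
  moreover have "h y mod W \<in> {0..<W}" using W by simp
  ultimately show ?thesis using assms(2) by (auto simp: part_def)
qed

lemma part_finite_card:
  assumes W: "0 < W" and K: "finite K" "K \<subseteq> carrier G" and x: "x \<in> carrier G"
  shows "finite (part W K x)" "card (part W K x) \<le> nat W * card K"
proof -
  let ?f = "\<lambda>(k, q::int). base W x \<otimes> k \<otimes> t [^] q"
  have sub: "part W K x \<subseteq> ?f ` (K \<times> {0..<W})"
  proof
    fix y assume y: "y \<in> part W K x"
    then have yc: "y \<in> carrier G" by (simp add: part_def)
    obtain k q where kq: "k \<in> K" "q \<in> {0..<W}" "inv (base W x) \<otimes> base W y = k" "y = base W y \<otimes> t [^] q"
      using part_elem[OF W y] by blast
    have "base W y = base W x \<otimes> k" using kq(3) x yc by (simp flip: kq(3) add: m_assoc[symmetric])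
    then have "y = ?f (k, q)" using kq(4) by simp
    then show "y \<in> ?f ` (K \<times> {0..<W})" using kq(1,2) by blast
  qed
  have fin: "finite (K \<times> {0..<W})" using K by simp
  then show "finite (part W K x)" using sub by (meson finite_imageI finite_subset)
  have "card (part W K x) \<le> card (?f ` (K \<times> {0..<W}))" using sub fin by (intro card_mono) auto
  also have "\<dots> \<le> card (K \<times> {0..<W})" using fin by (rule card_image_le)
  finally show "card (part W K x) \<le> nat W * card K" by (simp add: card_cartesian_product mult.commute)
qed

text \<open>
  Colour the blocks alternately.  Elements whose heights differ by less than the width of a block
  lie in the same block or in adjacent ones, so equal colours mean the same block; the displacement between
  the two moved elements is then one of the elements \<open>t^p x^-1 y t^-q\<close> of the kernel.  Hence
  pieces of equal colour are far apart as soon as \<open>K\<close> contains all such elements.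
\<close>

lemma near_in_part:
  assumes W: "0 < W" and x: "x \<in> carrier G" and y: "y \<in> carrier G"
    and par: "even (h x div W) \<longleftrightarrow> even (h y div W)" and near: "\<bar>h (inv x \<otimes> y)\<bar> < W"
    and K: "\<And>p q. p \<in> {0..<W} \<Longrightarrow> q \<in> {0..<W} \<Longrightarrow> p + h (inv x \<otimes> y) = q \<Longrightarrow>
      t [^] p \<otimes> (inv x \<otimes> y) \<otimes> t [^] (- q) \<in> K"
  shows "y \<in> part W K x"
proof -
  have hxy: "h (inv x \<otimes> y) = h y - h x" using x y by (simp add: h_mult h_inv)
  have eq: "h x = W * (h x div W) + h x mod W" "h y = W * (h y div W) + h y mod W" by simp_all
  have mods: "h x mod W \<in> {0..<W}" "h y mod W \<in> {0..<W}" using W by simp_all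
  have "h x div W = h y div W"
  proof -
    let ?d = "h y div W - h x div W"
    have "W * ?d = (h y - h x) - (h y mod W - h x mod W)" using eq unfolding right_diff_distrib by linarith
    then have "\<bar>W * ?d\<bar> < W * 2" using near mods unfolding hxy atLeastLessThan_iff by linarith
    then have "\<bar>?d\<bar> < 2" using W by (simp add: abs_mult)
    moreover have "even ?d" using par by auto
    moreover have "\<bar>z\<bar> < 2 \<Longrightarrow> even z \<Longrightarrow> z = 0" for z :: int by presburger
    ultimately have "?d = 0" by blast
    then show ?thesis by simp
  qed
  then have "h x mod W + h (inv x \<otimes> y) = h y mod W" unfolding hxy using eq by (smt (verit))
  from K[OF mods this] have "t [^] (h x mod W) \<otimes> (inv x \<otimes> y) \<otimes> t [^] (- (h y mod W)) \<in> K" .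
  moreover have "inv (base W x) \<otimes> base W y = t [^] (h x mod W) \<otimes> (inv x \<otimes> y) \<otimes> t [^] (- (h y mod W))"
    using x y by (simp add: base_def inv_mult_group m_assoc int_pow_neg)
  ultimately show ?thesis using y \<open>h x div W = h y div W\<close> by (simp add: part_def)
qed

lemma h_word_ball_bounded:
  assumes S: "S \<subseteq> carrier G" and b: "\<And>s. s \<in> S \<Longrightarrow> \<bar>h s\<bar> \<le> b" "0 \<le> b" and g: "g \<in> word_ball G S n"
  shows "\<bar>h g\<bar> \<le> int n * b"
  using g
proof (induction n arbitrary: g)
  case 0
  then show ?case by (simp add: h_one)
next
  case (Suc n)
  then obtain x s where g: "g = x \<otimes> s" "x \<in> word_ball G S n"
    and s: "s = \<one> \<or> s \<in> S \<or> (\<exists>s'\<in>S. s = inv s')" by auto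
  have c: "x \<in> carrier G" "s \<in> carrier G" using g s S word_ball_closed[OF S] by auto
  have "\<bar>h s\<bar> \<le> b" using s b S by (auto simp: h_one h_inv subset_iff)
  then have "\<bar>h x + h s\<bar> \<le> int n * b + b" using Suc.IH[OF g(2)] by linarith
  then show ?case using g(1) c by (simp add: h_mult algebra_simps)
qed

text \<open>
  The upper bound uses the pieces above, where \<open>K\<close> is generated by the finitely many possible
  displacements.  For the lower bound, a single family of separated sets must have only one
  member because the Cayley graph is connected, but the group is unbounded.
\<close>

theorem asdim_one:
  assumes fin: "finite S" and S: "S \<subseteq> carrier G" and gen: "generate G S = carrier G"
  shows "asdim (carrier G) (graph_dist (cayley_edges G S)) = 1"
proof -
  let ?d = "graph_dist (cayley_edges G S)"
  have dist: "?d x y \<le> enat n \<longleftrightarrow> inv x \<otimes> y \<in> word_ball G S n" if "x \<in> carrier G" "y \<in> carrier G" for x y n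
    using graph_dist_le_iff[OF S that] .
  define b where "b = Max (insert 0 ((\<lambda>e. \<bar>h e\<bar>) ` S))"
  have b: "0 \<le> b" "\<And>e. e \<in> S \<Longrightarrow> \<bar>h e\<bar> \<le> b"
    using fin unfolding b_def by (auto intro!: Max_ge)
  have hb: "\<bar>h g\<bar> \<le> int n * b" if "g \<in> word_ball G S n" for g n
    using S b(2,1) that by (rule h_word_ball_bounded)
  have le1: "asdim_le (carrier G) ?d 1"
    unfolding asdim_le_def
  proof
    fix R :: nat
    define W where "W = int R * b + 1"
    have W: "0 < W" using b(1) by (simp add: W_def add_nonneg_pos)
    define P where "P = {g. h g = 0} \<inter>
      (\<lambda>(p::int, s, q::int). t [^] p \<otimes> s \<otimes> t [^] (- q)) ` ({0..<W} \<times> word_ball G S R \<times> {0..<W})"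
    have "P \<subseteq> carrier G" using word_ball_closed[OF S, of R] by (auto simp: P_def)
    moreover have "finite P" unfolding P_def using finite_word_ball[OF fin] by (intro finite_Int disjI2 finite_imageI) simp
    moreover have "h e = 0" if "e \<in> P" for e using that by (simp add: P_def)
    ultimately have K: "subgroup (generate G P) G" "finite (generate G P)"
      using generate_is_subgroup locally_finite by auto
    define K where "K = generate G P"
    note K = K[folded K_def]
    have Kc: "K \<subseteq> carrier G" using K(1) by (rule subgroup.subset)
    have near: "y \<in> part W K x" if x: "x \<in> carrier G" and y: "y \<in> carrier G"
      and d: "?d x y \<le> enat R" and par: "even (h x div W) \<longleftrightarrow> even (h y div W)" for x y
    proof (rule near_in_part[OF W x y par])
      have xy: "inv x \<otimes> y \<in> word_ball G S R" using d dist[OF x y] by blast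
      then show "\<bar>h (inv x \<otimes> y)\<bar> < W" using hb by (fastforce simp: W_def)
      fix p q assume pq: "p \<in> {0..<W}" "q \<in> {0..<W}" "p + h (inv x \<otimes> y) = q"
      have "h (t [^] p \<otimes> (inv x \<otimes> y) \<otimes> t [^] (- q)) = 0"
        using x y pq(3) by (simp add: h_mult h_t_pow)
      then have "t [^] p \<otimes> (inv x \<otimes> y) \<otimes> t [^] (- q) \<in> P"
        using pq(1,2) xy unfolding P_def by (intro IntI image_eqI[of _ _ "(p, inv x \<otimes> y, q)"]) simp_all
      then show "t [^] p \<otimes> (inv x \<otimes> y) \<otimes> t [^] (- q) \<in> K" unfolding K_def by (rule generate.incl)
    qed
    define X where "X = (\<lambda>(q::int, k, q'::int). t [^] (- q) \<otimes> k \<otimes> t [^] q') ` ({0..<W} \<times> K \<times> {0..<W})"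
    have "finite X" unfolding X_def using K(2) by simp
    moreover have "X \<subseteq> carrier G" using Kc by (auto simp: X_def)
    ultimately obtain D where D: "X \<subseteq> word_ball G S D" using finite_subset_word_ball[OF S gen] by blast
    have diam: "?d x y \<le> enat D" if z: "z \<in> carrier G" and x: "x \<in> part W K z" and y: "y \<in> part W K z" for x y z
    proof -
      have c: "x \<in> carrier G" "y \<in> carrier G" using x y by (auto simp: part_def)
      have "y \<in> part W K x" using part_eq[OF K(1) z x] y by simp
      then have k: "inv (base W x) \<otimes> base W y \<in> K" by (simp add: part_def)
      obtain q q' where q: "q \<in> {0..<W}" "q' \<in> {0..<W}" "x = base W x \<otimes> t [^] q" "y = base W y \<otimes> t [^] q'"
        using part_elem[OF W x] part_elem[OF W y] by blast
      have "inv x \<otimes> y = inv (base W x \<otimes> t [^] q) \<otimes> (base W y \<otimes> t [^] q')" using q by simp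
      also have "\<dots> = t [^] (- q) \<otimes> (inv (base W x) \<otimes> base W y) \<otimes> t [^] q'"
        using c by (simp add: inv_mult_group m_assoc int_pow_neg)
      finally have "inv x \<otimes> y \<in> X" unfolding X_def
        using q k by (intro image_eqI[of _ _ "(q, inv (base W x) \<otimes> base W y, q')"]) simp_all
      then show ?thesis using dist[OF c] D by blast
    qed
    define U :: "nat \<Rightarrow> 'a set set" where
      "U i = {part W K x | x. x \<in> carrier G \<and> (even (h x div W) \<longleftrightarrow> i = 0)}" for i
    show "\<exists>(U :: nat \<Rightarrow> 'a set set) D. (\<Union>i\<le>1. \<Union>(U i)) = carrier G \<and>
        (\<forall>i\<le>1. \<forall>A\<in>U i. \<forall>x\<in>A. \<forall>y\<in>A. ?d x y \<le> enat D) \<and>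
        (\<forall>i\<le>1. \<forall>A\<in>U i. \<forall>B\<in>U i. A \<noteq> B \<longrightarrow> (\<forall>x\<in>A. \<forall>y\<in>B. enat R < ?d x y))"
    proof (intro exI[of _ U] exI[of _ D] conjI allI impI ballI)
      show "(\<Union>i\<le>1. \<Union>(U i)) = carrier G"
      proof
        show "(\<Union>i\<le>1. \<Union>(U i)) \<subseteq> carrier G" by (auto simp: U_def part_def)
        show "carrier G \<subseteq> (\<Union>i\<le>1. \<Union>(U i))"
        proof
          fix x assume x: "x \<in> carrier G"
          let ?i = "if even (h x div W) then 0 else 1 :: nat"
          have "part W K x \<in> U ?i" using x unfolding U_def by auto
          moreover have "?i \<le> 1" by simp
          ultimately show "x \<in> (\<Union>i\<le>1. \<Union>(U i))" using part_self[OF K(1) x] by blast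
        qed
      qed
      fix i A x y assume "A \<in> U i" "x \<in> A" "y \<in> A"
      then show "?d x y \<le> enat D" using diam by (auto simp: U_def)
    next
      fix i A B x y assume A: "A \<in> U i" and B: "B \<in> U i" and AB: "A \<noteq> B" and x: "x \<in> A" and y: "y \<in> B"
      obtain u v where u: "u \<in> carrier G" "A = part W K u" "even (h u div W) \<longleftrightarrow> i = 0"
        and v: "v \<in> carrier G" "B = part W K v" "even (h v div W) \<longleftrightarrow> i = 0"
        using A B by (auto simp: U_def)
      have xu: "x \<in> carrier G" "h x div W = h u div W" using x u(2) by (auto simp: part_def)
      have yv: "y \<in> carrier G" "h y div W = h v div W" using y v(2) by (auto simp: part_def)
      have "\<not> ?d x y \<le> enat R"
      proof
        assume "?d x y \<le> enat R"
        then have "y \<in> part W K x" using near xu yv u(3) v(3) by simp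
        then have "part W K y = part W K x" using part_eq[OF K(1) xu(1)] by blast
        then show False using AB x y u v part_eq[OF K(1)] by metis
      qed
      then show "enat R < ?d x y" by simp
    qed
  qed
  have not0: "\<not> asdim_le (carrier G) ?d 0"
  proof
    assume dim0: "asdim_le (carrier G) ?d 0"
    obtain U :: "nat \<Rightarrow> 'a set set" and D :: nat where
      "(\<Union>i\<le>0. \<Union>(U i)) = carrier G \<and>
        (\<forall>i\<le>0. \<forall>A\<in>U i. \<forall>x\<in>A. \<forall>y\<in>A. ?d x y \<le> enat D) \<and>
        (\<forall>i\<le>0. \<forall>A\<in>U i. \<forall>B\<in>U i. A \<noteq> B \<longrightarrow> (\<forall>x\<in>A. \<forall>y\<in>B. enat 1 < ?d x y))"
      using spec[OF dim0[unfolded asdim_le_def], of 1] by (elim exE) (rule that)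
    then have U: "\<Union>(U 0) = carrier G"
      "\<And>A x y. A \<in> U 0 \<Longrightarrow> x \<in> A \<Longrightarrow> y \<in> A \<Longrightarrow> ?d x y \<le> enat D"
      "\<And>A B x y. A \<in> U 0 \<Longrightarrow> B \<in> U 0 \<Longrightarrow> A \<noteq> B \<Longrightarrow> x \<in> A \<Longrightarrow> y \<in> B \<Longrightarrow> enat 1 < ?d x y"
      by auto
    obtain A where A: "A \<in> U 0" "\<one> \<in> A" using U(1) one_closed by blast
    have "g \<in> A" if "g \<in> word_ball G S n" for g n
      using that
    proof (induction n arbitrary: g)
      case 0
      then show ?case using A by simp
    next
      case (Suc n)
      then obtain x s where g: "g = x \<otimes> s" "x \<in> word_ball G S n"
        and s: "s = \<one> \<or> s \<in> S \<or> (\<exists>s'\<in>S. s = inv s')" by auto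
      have c: "x \<in> carrier G" "s \<in> carrier G" using g s S word_ball_closed[OF S] by auto
      then have gc: "g \<in> carrier G" using g by simp
      obtain B where B: "B \<in> U 0" "g \<in> B" using U(1) gc by blast
      have "inv x \<otimes> g = s" using g c by (simp add: m_assoc[symmetric])
      moreover have "s \<in> word_ball G S 1" using s word_ball_1I[OF S] word_ball_mono_Suc[OF S, of 0] by auto
      ultimately have "?d x g \<le> enat 1" using dist[OF c(1) gc] by simp
      then have "A = B" using U(3)[OF A(1) B(1) _ Suc.IH[OF g(2)] B(2)] by (meson leD)
      then show ?case using B by simp
    qed
    then have all: "g \<in> A" if "g \<in> carrier G" for g
      using generate_subset_Union_word_ball[OF S] that gen by blast
    let ?n = "int D * b + 1"
    have "?d \<one> (t [^] ?n) \<le> enat D" using U(2)[OF A(1)] all by simp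
    then have "t [^] ?n \<in> word_ball G S D" using dist[of \<one> "t [^] ?n" D] by simp
    then have "\<bar>h (t [^] ?n)\<bar> \<le> int D * b" by (rule hb)
    then show False by (simp add: h_t_pow)
  qed
  have "asdim (carrier G) ?d = enat 1"
    unfolding asdim_def
  proof (rule antisym)
    show "(INF n\<in>{n. asdim_le (carrier G) ?d n}. enat n) \<le> enat 1" using le1 by (intro INF_lower) simp
    show "enat 1 \<le> (INF n\<in>{n. asdim_le (carrier G) ?d n}. enat n)"
    proof (rule INF_greatest)
      fix n assume "n \<in> {n. asdim_le (carrier G) ?d n}"
      then have "n \<noteq> 0" using not0 by (metis mem_Collect_eq)
      then show "enat 1 \<le> enat n" by simp
    qed
  qed
  then show ?thesis by (simp add: one_enat_def)
qed

end

section \<open>Groups of permutations and their countable copies\<close>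

definition perm_group :: "('a \<Rightarrow> 'a) monoid" where
  "perm_group = \<lparr>carrier = {f. bij f}, monoid.mult = (\<circ>), one = id\<rparr>"

lemma perm_group_simps [simp]:
  "f \<in> carrier perm_group \<longleftrightarrow> bij f"
  "f \<otimes>\<^bsub>perm_group\<^esub> g = f \<circ> g"
  "\<one>\<^bsub>perm_group\<^esub> = id"
  by (simp_all add: perm_group_def)

lemma group_perm_group: "group (perm_group :: ('a \<Rightarrow> 'a) monoid)"
proof (rule groupI)
  fix f :: "'a \<Rightarrow> 'a" assume f: "f \<in> carrier perm_group"
  then have "inv_into UNIV f \<in> carrier perm_group" "inv_into UNIV f \<otimes>\<^bsub>perm_group\<^esub> f = \<one>\<^bsub>perm_group\<^esub>"
    by (simp_all add: bij_imp_bij_inv bij_is_inj)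
  then show "\<exists>g\<in>carrier perm_group. g \<otimes>\<^bsub>perm_group\<^esub> f = \<one>\<^bsub>perm_group\<^esub>" by blast
qed (auto simp: bij_comp comp_assoc)

text \<open>
  Powers in the permutation group are computed by recognising a one-parameter family.
\<close>

lemma perm_group_one_parameter:
  fixes f :: "int \<Rightarrow> 'a \<Rightarrow> 'a"
  assumes add: "\<And>i j. f (i + j) = f i \<circ> f j" and zero: "f 0 = id"
  shows "f 1 [^]\<^bsub>perm_group\<^esub> (i::int) = f i" "bij (f i)"
proof -
  interpret P: group perm_group by (rule group_perm_group)
  have inv: "f i \<circ> f (- i) = id" for i using add[of i "- i"] zero by simp
  then have bij: "bij (f i)" for i
    using inv[of i] inv[of "- i"] by (intro o_bij[of "f (- i)"]) simp_all
  then show "bij (f i)" .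
  have nat: "f 1 [^]\<^bsub>perm_group\<^esub> n = f (int n)" for n :: nat
  proof (induction n)
    case (Suc n)
    then show ?case using add[of "int n" 1] by (simp add: add.commute)
  qed (simp add: zero)
  show "f 1 [^]\<^bsub>perm_group\<^esub> i = f i"
  proof (cases i rule: int_cases2)
    case (nonneg n)
    then show ?thesis using nat by (simp add: int_pow_int)
  next
    case (nonpos n)
    have "inv\<^bsub>perm_group\<^esub> (f (int n)) = f (- int n)"
      using inv[of "- int n"] bij by (intro P.inv_equality) simp_all
    then show ?thesis using nonpos nat bij by (simp add: P.int_pow_neg int_pow_int)
  qed
qed

lemma (in group) countable_generate:
  assumes "finite S" "S \<subseteq> carrier G"
  shows "countable (generate G S)"
proof -
  have "generate G S \<subseteq> (\<Union>n. word_ball G S n)"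
    using generate_subset_Union_word_ball[OF assms(2)] by blast
  moreover have "countable (\<Union>n. word_ball G S n)"
    using finite_word_ball[OF assms(1)] by (intro countable_UN) (auto intro: countable_finite)
  ultimately show ?thesis by (rule countable_subset)
qed

text \<open>
  Transports a countable group to the natural numbers.  The inverse \<open>\<phi>\<close> of the enumeration is
  kept, so that computations in the copy can be done with the original elements.
\<close>

lemma (in group) nat_copy_of_subgroup:
  assumes K: "subgroup K G" and count: "countable K"
  shows "\<exists>(H :: nat monoid) \<phi>. group H \<and> \<phi> \<in> hom H G \<and> inj_on \<phi> (carrier H) \<and> \<phi> ` carrier H = K"
proof -
  obtain e :: "'a \<Rightarrow> nat" where e: "inj_on e K" using count by (auto simp: countable_def)
  define \<phi> where "\<phi> = inv_into K e"
  have \<phi>e: "\<phi> (e x) = x" if "x \<in> K" for x using e that by (simp add: \<phi>_def)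
  define H where "H = \<lparr>carrier = e ` K, monoid.mult = (\<lambda>x y. e (\<phi> x \<otimes> \<phi> y)), one = e \<one>\<rparr>"
  note closed = subgroup.m_closed[OF K] subgroup.one_closed[OF K] subgroup.m_inv_closed[OF K]
  have Kc: "x \<in> carrier G" if "x \<in> K" for x using that subgroup.subset[OF K] by blast
  have H: "carrier H = e ` K" "x \<otimes>\<^bsub>H\<^esub> y = e (\<phi> x \<otimes> \<phi> y)" "\<one>\<^bsub>H\<^esub> = e \<one>" for x y
    by (simp_all add: H_def)
  have "group H"
  proof (rule groupI)
    fix x assume "x \<in> carrier H"
    then obtain k where k: "k \<in> K" "x = e k" by (auto simp: H)
    have "e (inv k) \<otimes>\<^bsub>H\<^esub> x = \<one>\<^bsub>H\<^esub>" using k closed Kc by (simp add: H \<phi>e)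
    moreover have "e (inv k) \<in> carrier H" using k closed by (simp add: H)
    ultimately show "\<exists>y\<in>carrier H. y \<otimes>\<^bsub>H\<^esub> x = \<one>\<^bsub>H\<^esub>" by blast
  qed (auto simp: H \<phi>e closed Kc m_assoc)
  moreover have "\<phi> \<in> hom H G"
    by (rule homI) (auto simp: H \<phi>e closed Kc)
  moreover have "inj_on \<phi> (carrier H)"
    by (auto simp: H \<phi>e inj_on_def)
  moreover have "\<phi> ` carrier H = K"
    using \<phi>e by (force simp: H image_image)
  ultimately show ?thesis by blast
qed

section \<open>Lamps\<close>

text \<open>
  The separation of the two lamps of coordinate \<open>k + 1\<close> must exceed six times \<open>reach k\<close>, defined
  next.  The summand \<open>sep k + 1\<close> makes the sequence strictly increasing also where \<open>reach k\<close>
  vanishes.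
\<close>

primrec sep :: "nat \<Rightarrow> nat" where
  "sep 0 = 1"
| "sep (Suc k) = sep k + 6 * (k * (8 * sep k + 10)) + 1"

text \<open>
  Neighbouring points of the grid of coordinate \<open>k\<close> have distance at most \<open>8 * sep k + 10\<close>, so this
  bounds the distance of their images under a map with Lipschitz constant at most \<open>k\<close>.
\<close>

definition reach :: "nat \<Rightarrow> nat" where
  "reach k = k * (8 * sep k + 10)"

text \<open>
  Bounds the number of points, in the coordinates below \<open>k\<close> and with states below \<open>c\<close>, that
  lamps moved by at most \<open>m\<close> can affect: their positions lie between \<open>-m\<close> and \<open>sep k + m\<close>.
  It leads to the bound \<open>lamp_bound\<close> on the order of the group that these lamps generate: two sets of positions record what happens in the higher coordinates, a
  self-map of the affected points what happens in the lower ones.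
\<close>

definition cells :: "nat \<Rightarrow> nat \<Rightarrow> nat \<Rightarrow> nat" where
  "cells k m c = k * ((sep k + 2 * m + 1) * c)"

definition lamp_bound :: "nat \<Rightarrow> nat \<Rightarrow> nat \<Rightarrow> nat" where
  "lamp_bound k m c = 2 ^ (2 * m + 1) * 2 ^ (2 * m + 1) * cells k m c ^ cells k m c"

text \<open>
  Exceeds \<open>k\<close> times the size of the pieces into which a group without coordinate \<open>k\<close> is cut at
  scale \<open>reach k\<close>: a block has width \<open>reach k + 1\<close>, and \<open>3 * reach k\<close> bounds the length of the
  displacements within a block.
\<close>

definition span_from :: "nat \<Rightarrow> nat \<Rightarrow> nat" where
  "span_from k c = k * ((reach k + 1) * lamp_bound k (3 * reach k) c) + 1"

text \<open>
  An upper bound for the moduli of all coordinates below \<open>k\<close>.  With it, the modulus of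
  coordinate \<open>k\<close> can be chosen by primitive recursion although it depends on all earlier ones.
\<close>

primrec cap :: "nat \<Rightarrow> nat" where
  "cap 0 = 1"
| "cap (Suc k) = cap k + (2 * span_from k (cap k) + 1)"

definition side :: "nat \<Rightarrow> nat" where
  "side k = span_from k (cap k)"

text \<open>
  The modulus exceeds twice the side of the grid because the rotation that spans the grid moves
  states by two.
\<close>

definition modulus :: "nat \<Rightarrow> int" where
  "modulus k = 2 * int (side k) + 1"

lemma modulus_pos: "0 < modulus k"
  by (simp add: modulus_def)

lemma strict_mono_sep: "strict_mono sep"
  by (simp add: strict_mono_Suc_iff)

lemma sep_mono: "j \<le> k \<Longrightarrow> sep j \<le> sep k"
  using strict_mono_sep by (simp add: strict_mono_less_eq)

lemma reach_lt_sep: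
  assumes "k < j"
  shows "6 * reach k < sep j"
proof -
  have "6 * reach k < sep (Suc k)" by (simp add: reach_def)
  also have "sep (Suc k) \<le> sep j"
    using assms by (intro sep_mono) simp
  finally show ?thesis .
qed

lemma modulus_le_cap:
  assumes "j < k"
  shows "modulus j \<le> int (cap k)"
proof -
  have "modulus j \<le> int (cap (Suc j))" by (simp add: modulus_def side_def)
  also have "cap (Suc j) \<le> cap k"
    using lift_Suc_mono_le[of cap "Suc j" k] assms by simp
  finally show ?thesis by simp
qed

text \<open>
  A reflection of the cycle of residues modulo \<open>modulus j\<close>, extended by the identity to all
  integers so that it is a permutation of a type.
\<close>

definition flip :: "nat \<Rightarrow> int \<Rightarrow> int \<Rightarrow> int" where
  "flip j c w = (if 0 \<le> w \<and> w < modulus j then (c - w) mod modulus j else w)"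

lemma flip_flip [simp]: "flip j c (flip j c w) = w"
  using modulus_pos[of j] by (auto simp: flip_def mod_diff_right_eq)

type_synonym point = "nat \<times> int \<times> int"

text \<open>
  The lamp of coordinate \<open>j\<close> sits at position \<open>p j\<close>.  Conjugation by a translation moves all
  positions by the same amount (\<open>shift_lamp\<close>).
\<close>

definition lamp :: "nat set \<Rightarrow> int \<Rightarrow> (nat \<Rightarrow> int) \<Rightarrow> point \<Rightarrow> point" where
  "lamp M c p = (\<lambda>(j, z, w). (j, z, if j \<in> M \<and> z = p j then flip j c w else w))"

definition shift :: "int \<Rightarrow> point \<Rightarrow> point" where
  "shift i = (\<lambda>(j, z, w). (j, z + i, w))"

definition rot :: "nat \<Rightarrow> int \<Rightarrow> int \<Rightarrow> point \<Rightarrow> point" where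
  "rot k p i = (\<lambda>(j, z, w). (j, z,
     if j = k \<and> z = p \<and> 0 \<le> w \<and> w < modulus k then (w - 2 * i) mod modulus k else w))"

lemma lamp_lamp: "lamp M c p \<circ> lamp M c p = id"
  by (auto simp: lamp_def fun_eq_iff)

lemma bij_lamp: "bij (lamp M c p)"
  using lamp_lamp by (intro o_bij)

lemma shift_add: "shift (i + j) = shift i \<circ> shift j"
  by (auto simp: shift_def fun_eq_iff)

lemma shift_0: "shift 0 = id"
  by (auto simp: shift_def fun_eq_iff)

lemma rot_add: "rot k p (i + j) = rot k p i \<circ> rot k p j"
  using modulus_pos[of k] by (auto simp: rot_def fun_eq_iff mod_diff_left_eq algebra_simps)

lemma rot_0: "rot k p 0 = id"
  by (auto simp: rot_def fun_eq_iff)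

lemma rot_commute: "p \<noteq> q \<Longrightarrow> rot k p i \<circ> rot k q j = rot k q j \<circ> rot k p i"
  by (auto simp: rot_def fun_eq_iff)

lemma shift_lamp: "shift i \<circ> lamp M c p \<circ> shift (- i) = lamp M c (\<lambda>j. p j + i)"
  by (auto simp: shift_def lamp_def fun_eq_iff)

lemma shift_rot: "shift i \<circ> rot k p n \<circ> shift (- i) = rot k (p + i) n"
  by (auto simp: shift_def rot_def fun_eq_iff)

text \<open>
  After the translation, the two reflections of coordinate \<open>j\<close> sit at distance
  \<open>sep j - sep k\<close>.  They meet only for \<open>j = k\<close>, where their product rotates by one.  Everywhere
  else the product is an involution, which the square removes.
\<close>

lemma lamp_pair_square:
  assumes "k \<in> M"
  defines "f \<equiv> lamp M 0 (\<lambda>_. 0) \<circ> lamp M 1 (\<lambda>j. int (sep j) - int (sep k))"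
  shows "f \<circ> f = rot k 0 1"
proof
  fix x :: point
  obtain j z w where x: "x = (j, z, w)" by (cases x)
  have sep_eq: "sep j = sep k \<longleftrightarrow> j = k" using strict_mono_sep by (simp add: strict_mono_eq)
  show "(f \<circ> f) x = rot k 0 1 x"
  proof (cases "j = k \<and> z = 0")
    case True
    have "flip k 0 (flip k 1 w) = (if 0 \<le> w \<and> w < modulus k then (w - 1) mod modulus k else w)" for w
      using modulus_pos[of k] by (auto simp: flip_def mod_minus_eq)
    then show ?thesis using True assms(1) modulus_pos[of k]
      by (simp add: f_def x lamp_def rot_def mod_diff_left_eq)
  next
    case False
    then show ?thesis using sep_eq by (auto simp: f_def x lamp_def rot_def)
  qed
qed

definition cell_set :: "nat \<Rightarrow> nat \<Rightarrow> point set" where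
  "cell_set k m = {..<k} \<times> {- int m..int (sep k) + int m} \<times> {0..<int (cap k)}"

lemma card_cell_set: "card (cell_set k m) = cells k m (cap k)"
proof -
  have "card {- int m..int (sep k) + int m} = sep k + 2 * m + 1" by simp
  then show ?thesis unfolding cell_set_def card_cartesian_product cells_def by simp
qed

lemma finite_cell_set: "finite (cell_set k m)"
  by (simp add: cell_set_def)

text \<open>
  A normal form for products of lamps moved by at most \<open>m\<close>.  In the coordinates from \<open>k\<close> on, the
  sets \<open>E\<close> and \<open>F\<close> of positions tell which reflections are switched on near \<open>0\<close> and near
  \<open>sep j\<close>; they do not depend on \<open>j\<close>, which is why infinitely many coordinates contribute only
  finitely many possibilities.
\<close>

definition tame_perm ::
  "nat \<Rightarrow> nat \<Rightarrow> nat set \<Rightarrow> int set \<times> int set \<times> (point \<Rightarrow> point) \<Rightarrow> point \<Rightarrow> point" where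
  "tame_perm k m M = (\<lambda>(E, F, f) (j, z, w).
     if j < k then (if (j, z, w) \<in> cell_set k m then f (j, z, w) else (j, z, w))
     else (j, z, if j \<in> M \<and> z \<in> E then flip j 0 w
                 else if j \<in> M \<and> z - int (sep j) \<in> F then flip j 1 w else w))"

definition tame_codes :: "nat \<Rightarrow> nat \<Rightarrow> (int set \<times> int set \<times> (point \<Rightarrow> point)) set" where
  "tame_codes k m = Pow {- int m..int m} \<times> Pow {- int m..int m} \<times> (cell_set k m \<rightarrow>\<^sub>E cell_set k m)"

lemma finite_tame_codes: "finite (tame_codes k m)"
  by (simp add: tame_codes_def finite_cell_set finite_PiE)

lemma card_tame_codes: "card (tame_codes k m) = lamp_bound k m (cap k)"
proof -
  have "nat (int m + 1 - - int m) = 2 * m + 1" by simp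
  then show ?thesis
    by (simp add: tame_codes_def card_cartesian_product card_Pow card_funcsetE finite_cell_set
        card_cell_set lamp_bound_def)
qed

lemma id_tame: "id \<in> tame_perm k m M ` tame_codes k m"
proof
  show "id = tame_perm k m M ({}, {}, restrict id (cell_set k m))"
    by (auto simp: tame_perm_def fun_eq_iff)
  show "({}, {}, restrict id (cell_set k m)) \<in> tame_codes k m"
    by (auto simp: tame_codes_def)
qed

lemma lamp_in_cell_set:
  assumes "lamp M c p (j, z, w) \<noteq> (j, z, w)" "j < k" "- int m \<le> p j" "p j \<le> int (sep k) + int m"
  shows "(j, z, w) \<in> cell_set k m"
proof -
  have "z = p j" "0 \<le> w" "w < modulus j" using assms(1) by (auto simp: lamp_def flip_def split: if_splits)
  then show ?thesis using assms(2-4) modulus_le_cap[OF assms(2)] by (auto simp: cell_set_def)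
qed

lemma lamp_preserves_cell_set:
  assumes "x \<in> cell_set k m"
  shows "lamp M c p x \<in> cell_set k m"
proof -
  obtain j z w where x: "x = (j, z, w)" by (cases x)
  show ?thesis
    using assms modulus_le_cap[of j k] order.strict_trans2[OF pos_mod_bound, OF modulus_pos, of j]
    by (auto simp: x lamp_def cell_set_def flip_def modulus_pos)
qed

lemma lamp_tame:
  assumes i: "- int m \<le> i" "i \<le> int m"
  shows "lamp M 0 (\<lambda>_. i) \<in> tame_perm k m M ` tame_codes k m"
    and "lamp M 1 (\<lambda>j. int (sep j) + i) \<in> tame_perm k m M ` tame_codes k m"
proof -
  let ?a = "lamp M 0 (\<lambda>_. i)" and ?b = "lamp M 1 (\<lambda>j. int (sep j) + i)"
  have "?a = tame_perm k m M ({i}, {}, restrict ?a (cell_set k m))"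
  proof
    fix x :: point
    obtain j z w where x: "x = (j, z, w)" by (cases x)
    show "?a x = tame_perm k m M ({i}, {}, restrict ?a (cell_set k m)) x"
    proof (cases "j < k")
      case True
      then have "?a x = x" if "x \<notin> cell_set k m"
        using that i lamp_in_cell_set[of M 0 "\<lambda>_. i" j z w k m] by (auto simp: x)
      then show ?thesis using True by (auto simp: x tame_perm_def)
    qed (auto simp: x tame_perm_def lamp_def)
  qed
  moreover have "({i}, {}, restrict ?a (cell_set k m)) \<in> tame_codes k m"
    using i lamp_preserves_cell_set by (auto simp: tame_codes_def)
  ultimately show "?a \<in> tame_perm k m M ` tame_codes k m" by (rule image_eqI)
  have "?b = tame_perm k m M ({}, {i}, restrict ?b (cell_set k m))"
  proof
    fix x :: point
    obtain j z w where x: "x = (j, z, w)" by (cases x)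
    show "?b x = tame_perm k m M ({}, {i}, restrict ?b (cell_set k m)) x"
    proof (cases "j < k")
      case True
      then have "sep j \<le> sep k" by (intro sep_mono) simp
      then have "?b x = x" if "x \<notin> cell_set k m"
        using that True i lamp_in_cell_set[of M 1 "\<lambda>j. int (sep j) + i" j z w k m] by (auto simp: x)
      then show ?thesis using True by (auto simp: x tame_perm_def)
    qed (auto simp: x tame_perm_def lamp_def)
  qed
  moreover have "({}, {i}, restrict ?b (cell_set k m)) \<in> tame_codes k m"
    using i lamp_preserves_cell_set by (auto simp: tame_codes_def)
  ultimately show "?b \<in> tame_perm k m M ` tame_codes k m" by (rule image_eqI)
qed

text \<open>
  In the high coordinates the two windows for lamps are disjoint, so all reflections commute and
  composition is the symmetric difference of the sets of positions.
\<close>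

lemma comp_tame:
  assumes far: "\<And>j. j \<in> M \<Longrightarrow> k \<le> j \<Longrightarrow> 2 * m < sep j"
    and f: "f \<in> tame_perm k m M ` tame_codes k m" and g: "g \<in> tame_perm k m M ` tame_codes k m"
  shows "f \<circ> g \<in> tame_perm k m M ` tame_codes k m"
proof -
  obtain E F u where f: "f = tame_perm k m M (E, F, u)" and
    E: "E \<subseteq> {- int m..int m}" and F: "F \<subseteq> {- int m..int m}" and u: "u \<in> cell_set k m \<rightarrow>\<^sub>E cell_set k m"
    using f by (auto simp: tame_codes_def)
  obtain E' F' u' where g: "g = tame_perm k m M (E', F', u')" and
    E': "E' \<subseteq> {- int m..int m}" and F': "F' \<subseteq> {- int m..int m}" and u': "u' \<in> cell_set k m \<rightarrow>\<^sub>E cell_set k m"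
    using g by (auto simp: tame_codes_def)
  let ?E = "(E - E') \<union> (E' - E)" and ?F = "(F - F') \<union> (F' - F)"
  let ?u = "restrict (u \<circ> u') (cell_set k m)"
  have "f \<circ> g = tame_perm k m M (?E, ?F, ?u)"
  proof
    fix x :: point
    obtain j z w where x: "x = (j, z, w)" by (cases x)
    show "(f \<circ> g) x = tame_perm k m M (?E, ?F, ?u) x"
    proof (cases "j < k")
      case True
      show ?thesis
      proof (cases "x \<in> cell_set k m")
        case cell: True
        then have "u' x \<in> cell_set k m" using u' by blast
        moreover obtain j' z' w' where "u' x = (j', z', w')" by (cases "u' x")
        moreover have "j' < k" using calculation by (simp add: cell_set_def)
        ultimately show ?thesis using cell True by (simp add: f g x tame_perm_def)
      next
        case False
        then show ?thesis using True by (simp add: f g x tame_perm_def)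
      qed
    next
      case False
      have "z \<notin> E \<union> E' \<or> z - int (sep j) \<notin> F \<union> F'" if "j \<in> M"
        using far[OF that] False E E' F F' by force
      then show ?thesis using False by (auto simp: f g x tame_perm_def)
    qed
  qed
  moreover have "?u \<in> cell_set k m \<rightarrow>\<^sub>E cell_set k m" using u u' by auto
  then have "(?E, ?F, ?u) \<in> tame_codes k m" using E E' F F' by (auto simp: tame_codes_def)
  ultimately show ?thesis by (rule image_eqI)
qed

section \<open>The groups\<close>

text \<open>
  The group is known through a faithful action \<open>\<phi>\<close>, which leaves the type of its elements open.
\<close>

locale lamp_group = group +
  fixes M :: "nat set" and \<phi> :: "'a \<Rightarrow> point \<Rightarrow> point" and t a b :: 'a
  assumes hom_\<phi>: "\<phi> \<in> hom G perm_group" and inj_\<phi>: "inj_on \<phi> (carrier G)"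
    and gens_closed: "t \<in> carrier G" "a \<in> carrier G" "b \<in> carrier G"
    and generates: "generate G {t, a, b} = carrier G"
    and \<phi>_t: "\<phi> t = shift 1"
    and \<phi>_a: "\<phi> a = lamp M 0 (\<lambda>_. 0)"
    and \<phi>_b: "\<phi> b = lamp M 1 (\<lambda>j. int (sep j))"
begin

lemmas [simp] = gens_closed

lemma gens_subset: "{t, a, b} \<subseteq> carrier G"
  by simp

lemma group_hom_\<phi>: "group_hom G perm_group \<phi>"
  using hom_\<phi> group_perm_group is_group by (simp add: group_hom_def group_hom_axioms_def)

lemma \<phi>_mult: "x \<in> carrier G \<Longrightarrow> y \<in> carrier G \<Longrightarrow> \<phi> (x \<otimes> y) = \<phi> x \<circ> \<phi> y"
  using hom_mult[OF hom_\<phi>] by simp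

lemma \<phi>_one: "\<phi> \<one> = id"
  using group_hom.hom_one[OF group_hom_\<phi>] by simp

lemma \<phi>_eqI: "x \<in> carrier G \<Longrightarrow> y \<in> carrier G \<Longrightarrow> \<phi> x = \<phi> y \<Longrightarrow> x = y"
  using inj_\<phi> by (rule inj_onD)

lemma \<phi>_power:
  assumes "x \<in> carrier G" "\<phi> x = f 1" "\<And>i j. f (i + j) = f i \<circ> f j" "f 0 = id"
  shows "\<phi> (x [^] (i::int)) = f i"
  using group_hom.hom_int_pow[OF group_hom_\<phi> assms(1), of i] perm_group_one_parameter(1)[of f i] assms
  by simp

lemma \<phi>_t_pow: "\<phi> (t [^] (i::int)) = shift i"
  by (rule \<phi>_power[where f = shift, OF _ _ shift_add shift_0]) (simp_all add: \<phi>_t)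

text \<open>
  Every element moves all positions by the same amount (\<open>\<phi>_height\<close>), which can therefore be read
  off at one point.
\<close>

definition height :: "'a \<Rightarrow> int" where
  "height x = fst (snd (\<phi> x (0, 0, 0)))"

lemma \<phi>_height:
  assumes "x \<in> carrier G"
  shows "fst (\<phi> x (j, z, w)) = j \<and> fst (snd (\<phi> x (j, z, w))) = z + height x"
proof -
  let ?T = "\<lambda>x c. \<forall>j z w. fst (\<phi> x (j, z, w)) = j \<and> fst (snd (\<phi> x (j, z, w))) = z + c"
  have "\<exists>c. ?T x c" if "x \<in> word_ball G {t, a, b} n" for n
    using that
  proof (induction n arbitrary: x)
    case 0
    then show ?case by (auto simp: \<phi>_one)
  next
    case (Suc n)
    then obtain y s where y: "x = y \<otimes> s" "y \<in> word_ball G {t, a, b} n"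
      and s: "s = \<one> \<or> s \<in> {t, a, b} \<or> (\<exists>s'\<in>{t, a, b}. s = inv s')" by auto
    have c: "y \<in> carrier G" "s \<in> carrier G"
      using y s word_ball_closed[OF gens_subset] by auto
    obtain cy where cy: "?T y cy" using Suc.IH[OF y(2)] by blast
    have gen: "?T t 1" "?T a 0" "?T b 0"
      by (simp_all add: \<phi>_t \<phi>_a \<phi>_b shift_def lamp_def)
    have inv: "?T (inv g) (- c)" if g: "g \<in> carrier G" "?T g c" for g c
    proof (intro allI)
      fix j z w
      obtain j' z' w' where e: "\<phi> (inv g) (j, z, w) = (j', z', w')" by (metis prod_cases3)
      have "\<phi> g (j', z', w') = (\<phi> g \<circ> \<phi> (inv g)) (j, z, w)" by (simp add: e)
      also have "\<dots> = (j, z, w)" using g(1) by (simp flip: \<phi>_mult add: \<phi>_one)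
      finally have "\<phi> g (j', z', w') = (j, z, w)" .
      then have "j = j'" "z = z' + c" using g(2) by (metis fst_conv snd_conv)+
      then show "fst (\<phi> (inv g) (j, z, w)) = j \<and> fst (snd (\<phi> (inv g) (j, z, w))) = z + - c"
        unfolding e by simp
    qed
    have "?T \<one> 0" by (simp add: \<phi>_one)
    then obtain cs where cs: "?T s cs"
      using s gen inv[OF _ gen(1)] inv[OF _ gen(2)] inv[OF _ gen(3)] by (metis empty_iff gens_closed insert_iff)
    have "?T x (cs + cy)"
    proof (intro allI)
      fix j z w
      obtain j' z' w' where e: "\<phi> s (j, z, w) = (j', z', w')" by (metis prod_cases3)
      then have "j' = j" "z' = z + cs" using cs by (metis fst_conv snd_conv)+
      then show "fst (\<phi> x (j, z, w)) = j \<and> fst (snd (\<phi> x (j, z, w))) = z + (cs + cy)"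
        using cy by (simp add: y(1) \<phi>_mult c e)
    qed
    then show ?case by blast
  qed
  then obtain c where c: "?T x c"
    using generate_subset_Union_word_ball[OF gens_subset, of x] generates assms by blast
  then have "height x = c" by (simp add: height_def)
  then show ?thesis using c by simp
qed

lemma height_mult:
  assumes "x \<in> carrier G" "y \<in> carrier G"
  shows "height (x \<otimes> y) = height x + height y"
proof -
  obtain j z w where e: "\<phi> y (0, 0, 0) = (j, z, w)" by (metis prod_cases3)
  then have "z = height y" by (simp add: height_def)
  then show ?thesis using \<phi>_height[OF assms(1), of j z w] assms e by (simp add: height_def[of "x \<otimes> y"] \<phi>_mult)
qed

lemma height_gens: "height t = 1" "height a = 0" "height b = 0"
  by (simp_all add: height_def \<phi>_t \<phi>_a \<phi>_b shift_def lamp_def)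

lemma height_inv: "x \<in> carrier G \<Longrightarrow> height (inv x) = - height x"
  using height_mult[of x "inv x"] \<phi>_one by (simp add: height_def[of \<one>])

definition lamps :: "nat \<Rightarrow> 'a set" where
  "lamps m = {t [^] i \<otimes> x \<otimes> t [^] (- i) | i x. - int m \<le> i \<and> i \<le> int m \<and> x \<in> {a, b}}"

definition lamp_subgroup :: "nat \<Rightarrow> 'a set" where
  "lamp_subgroup m = generate G (lamps m)"

lemma lamps_closed: "lamps m \<subseteq> carrier G"
  by (auto simp: lamps_def)

lemma subgroup_lamp_subgroup: "subgroup (lamp_subgroup m) G"
  unfolding lamp_subgroup_def using lamps_closed by (rule generate_is_subgroup)

lemma lamp_subgroup_closed: "lamp_subgroup m \<subseteq> carrier G"
  using subgroup_lamp_subgroup by (rule subgroup.subset)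

lemma lamp_subgroup_mono: "m \<le> n \<Longrightarrow> lamp_subgroup m \<subseteq> lamp_subgroup n"
  unfolding lamp_subgroup_def by (rule mono_generate) (force simp: lamps_def)

lemma \<phi>_lamps:
  assumes "x \<in> lamps m"
  shows "\<exists>i. - int m \<le> i \<and> i \<le> int m \<and>
    (\<phi> x = lamp M 0 (\<lambda>_. i) \<or> \<phi> x = lamp M 1 (\<lambda>j. int (sep j) + i))"
proof -
  obtain i y where i: "- int m \<le> i" "i \<le> int m" "y \<in> {a, b}" "x = t [^] i \<otimes> y \<otimes> t [^] (- i)"
    using assms by (auto simp: lamps_def)
  have "\<phi> x = shift i \<circ> \<phi> y \<circ> shift (- i)"
    using i(3) by (auto simp: i(4) \<phi>_mult \<phi>_t_pow)
  then show ?thesis using i shift_lamp[of i M] by (auto simp: \<phi>_a \<phi>_b)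
qed

lemma \<phi>_lamp_subgroup_tame:
  assumes far: "\<And>j. j \<in> M \<Longrightarrow> k \<le> j \<Longrightarrow> 2 * m < sep j"
    and "x \<in> lamp_subgroup m"
  shows "\<phi> x \<in> tame_perm k m M ` tame_codes k m"
  using assms(2) unfolding lamp_subgroup_def
proof (induction rule: generate.induct)
  case one
  show ?case unfolding \<phi>_one by (rule id_tame)
next
  case (incl x)
  then show ?case using \<phi>_lamps[OF incl] lamp_tame by force
next
  case (inv x)
  have x: "x \<in> carrier G" using inv lamps_closed by blast
  have "\<phi> x \<circ> \<phi> x = id" using \<phi>_lamps[OF inv] lamp_lamp by metis
  then have "x \<otimes> x = \<one>" using x by (intro \<phi>_eqI) (simp_all add: \<phi>_mult \<phi>_one)
  then have "inv x = x" using x by (simp add: inv_equality)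
  then show ?case using \<phi>_lamps[OF inv] lamp_tame by force
next
  case (eng x y)
  have "\<phi> x \<circ> \<phi> y \<in> tame_perm k m M ` tame_codes k m" using far eng(3,4) by (rule comp_tame)
  then show ?case
    using eng(1,2) generate_in_carrier[OF lamps_closed] by (simp only: \<phi>_mult)
qed

lemma lamp_subgroup_finite_card:
  assumes far: "\<And>j. j \<in> M \<Longrightarrow> k \<le> j \<Longrightarrow> 2 * m < sep j"
  shows "finite (lamp_subgroup m)" "card (lamp_subgroup m) \<le> lamp_bound k m (cap k)"
proof -
  have sub: "\<phi> ` lamp_subgroup m \<subseteq> tame_perm k m M ` tame_codes k m"
    using \<phi>_lamp_subgroup_tame[OF far] by blast
  have inj: "inj_on \<phi> (lamp_subgroup m)"
    using inj_\<phi> lamp_subgroup_closed by (rule inj_on_subset)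
  have fin: "finite (tame_perm k m M ` tame_codes k m)" using finite_tame_codes by simp
  show "finite (lamp_subgroup m)"
    using finite_imageD[OF finite_subset[OF sub fin] inj] .
  have "card (lamp_subgroup m) = card (\<phi> ` lamp_subgroup m)" using inj by (simp add: card_image)
  also have "\<dots> \<le> card (tame_perm k m M ` tame_codes k m)" using fin sub by (rule card_mono)
  also have "\<dots> \<le> card (tame_codes k m)" using finite_tame_codes by (rule card_image_le)
  finally show "card (lamp_subgroup m) \<le> lamp_bound k m (cap k)" by (simp add: card_tame_codes)
qed

lemma lamp_subgroup_finite: "finite (lamp_subgroup m)"
proof (rule lamp_subgroup_finite_card(1))
  fix j assume "2 * m + 1 \<le> j"
  then show "2 * m < sep j"
    using strict_mono_imp_increasing[OF strict_mono_sep, of j] by linarith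
qed

text \<open>
  Reading a word of length \<open>n\<close> from the left and collecting the translations at the right end
  leaves a product of lamps conjugated by the prefixes, which have height at most \<open>n\<close>.
\<close>

lemma word_ball_lamps:
  assumes "g \<in> word_ball G {t, a, b} n"
  shows "\<bar>height g\<bar> \<le> int n \<and> g \<otimes> t [^] (- height g) \<in> lamp_subgroup n"
  using assms
proof (induction n arbitrary: g)
  case 0
  then show ?case using subgroup.one_closed[OF subgroup_lamp_subgroup] \<phi>_one by (simp add: height_def)
next
  case (Suc n)
  then obtain x s where x: "g = x \<otimes> s" "x \<in> word_ball G {t, a, b} n"
    and s: "s = \<one> \<or> s \<in> {t, a, b} \<or> (\<exists>s'\<in>{t, a, b}. s = inv s')" by auto
  have c: "x \<in> carrier G" "s \<in> carrier G"
    using x s word_ball_closed[OF gens_subset] by auto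
  have IH: "\<bar>height x\<bar> \<le> int n" "x \<otimes> t [^] (- height x) \<in> lamp_subgroup (Suc n)"
    using Suc.IH[OF x(2)] lamp_subgroup_mono[of n "Suc n"] by auto
  have hg: "height g = height x + height s" using x(1) c by (simp add: height_mult)
  consider "s = t [^] height s" "\<bar>height s\<bar> \<le> 1" | s' where "s' \<in> {a, b}" "s = s' \<or> s = inv s'"
  proof -
    consider "s = \<one>" | "s = t" | "s = inv t" | s' where "s' \<in> {a, b}" "s = s' \<or> s = inv s'"
      using s by auto
    then show ?thesis
      using that by cases (auto simp: height_gens height_inv int_pow_neg height_def[of \<one>] \<phi>_one)
  qed
  then show ?case
  proof cases
    case 1
    have "g \<otimes> t [^] (- height g) = x \<otimes> (s \<otimes> t [^] (- height s)) \<otimes> t [^] (- height x)"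
      using c unfolding hg add.commute[of "height x"] by (simp add: x(1) m_assoc int_pow_mult[symmetric])
    also have "s \<otimes> t [^] (- height s) = \<one>" by (subst 1(1)) (simp add: int_pow_mult[symmetric])
    finally show ?thesis using IH 1(2) c hg by simp
  next
    case 2
    have hs: "height s = 0" using 2 by (auto simp: height_gens height_inv)
    let ?l = "t [^] height x \<otimes> s' \<otimes> t [^] (- height x)"
    have s': "s' \<in> carrier G" using 2 by auto
    have l: "?l \<in> lamps (Suc n)" using IH(1) 2(1) unfolding lamps_def by force
    have "t [^] height x \<otimes> s \<otimes> t [^] (- height x) = ?l \<or>
      t [^] height x \<otimes> s \<otimes> t [^] (- height x) = inv ?l"
      using 2(2) s' by (auto simp: inv_mult_group m_assoc int_pow_neg)
    then have "t [^] height x \<otimes> s \<otimes> t [^] (- height x) \<in> lamp_subgroup (Suc n)"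
      unfolding lamp_subgroup_def using l by (auto intro: generate.incl generate.inv)
    then have "(x \<otimes> t [^] (- height x)) \<otimes> (t [^] height x \<otimes> s \<otimes> t [^] (- height x)) \<in> lamp_subgroup (Suc n)"
      using IH(2) subgroup.m_closed[OF subgroup_lamp_subgroup] by blast
    moreover have "(x \<otimes> t [^] (- height x)) \<otimes> (t [^] height x \<otimes> s \<otimes> t [^] (- height x)) = g \<otimes> t [^] (- height g)"
    proof -
      have "t [^] (- height x) \<otimes> (t [^] height x \<otimes> (s \<otimes> t [^] (- height x))) = s \<otimes> t [^] (- height x)"
        using c by (simp add: int_pow_neg flip: m_assoc)
      then show ?thesis using c unfolding hg hs by (simp add: x(1) m_assoc)
    qed
    ultimately show ?thesis using IH(1) hg hs by simp
  qed
qed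

lemma locally_finite_by_int: "locally_finite_by_int G height t"
proof
  show "height (x \<otimes> y) = height x + height y" if "x \<in> carrier G" "y \<in> carrier G" for x y
    using that by (rule height_mult)
  show "t \<in> carrier G" "height t = 1" by (simp_all add: height_gens)
  fix E assume E: "finite E" "E \<subseteq> carrier G" and h: "\<And>e. e \<in> E \<Longrightarrow> height e = 0"
  obtain n where n: "E \<subseteq> word_ball G {t, a, b} n"
    using finite_subset_word_ball[OF gens_subset generates E] by blast
  have "E \<subseteq> lamp_subgroup n"
  proof
    fix e assume e: "e \<in> E"
    then show "e \<in> lamp_subgroup n"
      using word_ball_lamps[of e n] n subsetD[OF E(2) e] h[OF e] by (simp add: subset_iff)
  qed
  then have "generate G E \<subseteq> lamp_subgroup n"
    using subgroup_lamp_subgroup by (rule generate_subgroup_incl)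
  then show "finite (generate G E)" using lamp_subgroup_finite by (rule finite_subset)
qed

lemma t_pow_word_ball: "t [^] (i::int) \<in> word_ball G {t, a, b} (nat \<bar>i\<bar>)"
proof -
  have n: "t [^] n \<in> word_ball G {t, a, b} n" for n :: nat
    using word_ball_pow[OF gens_subset word_ball_1I(1)[OF gens_subset], of t n] by simp
  show ?thesis
  proof (cases i rule: int_cases2)
    case (nonneg m)
    then show ?thesis using n[of m] by (simp add: int_pow_int)
  next
    case (nonpos m)
    then show ?thesis using word_ball_inv[OF gens_subset n[of m]] by (simp add: int_pow_neg int_pow_int)
  qed
qed

subsection \<open>Large grids inside the group\<close>

text \<open>
  The rotations that span the grid of a coordinate \<open>k \<in> M\<close>: \<open>turn k\<close> acts at position \<open>0\<close> of coordinate \<open>k\<close>, and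
  \<open>turn' k\<close>, which commutes with it, at position \<open>1\<close>.
\<close>

definition turn :: "nat \<Rightarrow> 'a" where
  "turn k = (let c = a \<otimes> (t [^] (- int (sep k)) \<otimes> b \<otimes> t [^] int (sep k)) in c \<otimes> c)"

definition turn' :: "nat \<Rightarrow> 'a" where
  "turn' k = t \<otimes> turn k \<otimes> inv t"

definition grid_point :: "nat \<Rightarrow> int \<Rightarrow> int \<Rightarrow> 'a" where
  "grid_point k i j = turn k [^] i \<otimes> turn' k [^] j"

lemma turn_closed [simp]: "turn k \<in> carrier G" "turn' k \<in> carrier G" "grid_point k i j \<in> carrier G"
  by (simp_all add: turn_def turn'_def grid_point_def Let_def)

lemma turn_word_ball:
  "turn k \<in> word_ball G {t, a, b} (4 * sep k + 4)" "turn' k \<in> word_ball G {t, a, b} (4 * sep k + 6)"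
proof -
  let ?B = "word_ball G {t, a, b}" and ?l = "int (sep k)"
  note mult = word_ball_mult[OF gens_subset] and one = word_ball_1I[OF gens_subset]
  have "t [^] (- ?l) \<in> ?B (sep k)" "t [^] ?l \<in> ?B (sep k)"
    using t_pow_word_ball[of "- ?l"] t_pow_word_ball[of ?l] by simp_all
  then have "a \<otimes> (t [^] (- ?l) \<otimes> b \<otimes> t [^] ?l) \<in> ?B (1 + (sep k + 1 + sep k))"
    using one by (intro mult) auto
  from mult[OF this this] have "turn k \<in> ?B (1 + (sep k + 1 + sep k) + (1 + (sep k + 1 + sep k)))"
    unfolding turn_def Let_def .
  also have "1 + (sep k + 1 + sep k) + (1 + (sep k + 1 + sep k)) = 4 * sep k + 4" by simp
  finally show u: "turn k \<in> ?B (4 * sep k + 4)" .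
  have "turn' k \<in> ?B (1 + (4 * sep k + 4) + 1)"
    unfolding turn'_def using one u by (intro mult) auto
  also have "1 + (4 * sep k + 4) + 1 = 4 * sep k + 6" by simp
  finally show "turn' k \<in> ?B (4 * sep k + 6)" .
qed

lemma small_power_word_ball:
  assumes "x \<in> carrier G" "x \<in> word_ball G {t, a, b} n" "\<bar>i\<bar> \<le> (1::int)"
  shows "x [^] i \<in> word_ball G {t, a, b} n"
proof -
  have "i = 0 \<or> i = 1 \<or> i = - 1" using assms(3) by linarith
  then show ?thesis
    using assms word_ball_inv[OF gens_subset assms(2)] word_ball_mono[OF gens_subset, of 0 n]
    by (auto simp: int_pow_neg)
qed

lemma grid_point_word_ball:
  assumes "\<bar>i\<bar> \<le> 1" "\<bar>j\<bar> \<le> 1"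
  shows "grid_point k i j \<in> word_ball G {t, a, b} (8 * sep k + 10)"
  using word_ball_mult[OF gens_subset small_power_word_ball[OF turn_closed(1) turn_word_ball(1) assms(1)]
      small_power_word_ball[OF turn_closed(2) turn_word_ball(2) assms(2)], of k k]
  by (simp add: grid_point_def)

lemma \<phi>_grid_point:
  assumes k: "k \<in> M"
  shows "\<phi> (grid_point k i j) = rot k 0 i \<circ> rot k 1 j"
proof -
  let ?l = "int (sep k)"
  have "\<phi> (t [^] (- ?l) \<otimes> b \<otimes> t [^] ?l) = lamp M 1 (\<lambda>j. int (sep j) - int (sep k))"
    using shift_lamp[of "- ?l" M 1 "\<lambda>j. int (sep j)"] by (simp add: \<phi>_mult \<phi>_t_pow \<phi>_b)
  then have u: "\<phi> (turn k) = rot k 0 1"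
    using lamp_pair_square[OF k] by (simp add: turn_def Let_def \<phi>_mult \<phi>_a)
  have "\<phi> (inv t) = shift (- 1)" using \<phi>_t_pow[of "- 1"] by (simp add: int_pow_neg)
  then have v: "\<phi> (turn' k) = rot k 1 1"
    using shift_rot[of 1 k 0 1] by (simp add: turn'_def \<phi>_mult \<phi>_t u)
  have "\<phi> (turn k [^] i) = rot k 0 i" "\<phi> (turn' k [^] j) = rot k 1 j"
    using \<phi>_power[where f = "rot k 0", OF _ u rot_add rot_0] \<phi>_power[where f = "rot k 1", OF _ v rot_add rot_0]
    by simp_all
  then show ?thesis by (simp add: grid_point_def \<phi>_mult)
qed

lemma grid_point_step:
  assumes "k \<in> M"
  shows "inv (grid_point k i j) \<otimes> grid_point k i' j' = grid_point k (i' - i) (j' - j)"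
proof -
  have "grid_point k i' j' = grid_point k i j \<otimes> grid_point k (i' - i) (j' - j)"
  proof (rule \<phi>_eqI)
    have "(rot k 0 i \<circ> rot k 1 j) \<circ> (rot k 0 (i' - i) \<circ> rot k 1 (j' - j)) =
        rot k 0 i \<circ> (rot k 1 j \<circ> rot k 0 (i' - i)) \<circ> rot k 1 (j' - j)"
      by (simp add: comp_assoc)
    also have "\<dots> = rot k 0 i \<circ> (rot k 0 (i' - i) \<circ> rot k 1 j) \<circ> rot k 1 (j' - j)"
      by (simp add: rot_commute)
    also have "\<dots> = (rot k 0 i \<circ> rot k 0 (i' - i)) \<circ> (rot k 1 j \<circ> rot k 1 (j' - j))"
      by (simp add: comp_assoc)
    also have "\<dots> = rot k 0 i' \<circ> rot k 1 j'" by (simp flip: rot_add)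
    finally show "\<phi> (grid_point k i' j') = \<phi> (grid_point k i j \<otimes> grid_point k (i' - i) (j' - j))"
      by (simp add: \<phi>_mult \<phi>_grid_point[OF assms])
  qed simp_all
  then show ?thesis by (simp flip: m_assoc)
qed

lemma double_mod_inj:
  assumes "0 \<le> i" "i \<le> int (side k)" "0 \<le> j" "j \<le> int (side k)"
    and "(- (2 * i)) mod modulus k = (- (2 * j)) mod modulus k"
  shows "i = j"
proof -
  have "modulus k dvd - (2 * i) - - (2 * j)" using assms(5) by (simp add: mod_eq_dvd_iff)
  moreover have "\<bar>- (2 * i) - - (2 * j)\<bar> < modulus k" using assms by (simp add: modulus_def)
  ultimately have "- (2 * i) - - (2 * j) = 0"
    using dvd_imp_le_int[of "- (2 * i) - - (2 * j)" "modulus k"] by linarith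
  then show ?thesis by simp
qed

lemma grid_point_inj:
  assumes k: "k \<in> M" and "i \<in> {0..int (side k)}" "j \<in> {0..int (side k)}"
    "i' \<in> {0..int (side k)}" "j' \<in> {0..int (side k)}"
    and eq: "grid_point k i j = grid_point k i' j'"
  shows "i = i' \<and> j = j'"
proof -
  have "(rot k 0 i \<circ> rot k 1 j) x = (rot k 0 i' \<circ> rot k 1 j') x" for x
    using \<phi>_grid_point[OF k, of i j] \<phi>_grid_point[OF k, of i' j'] eq by simp
  from this[of "(k, 0, 0)"] this[of "(k, 1, 0)"]
  have "(- (2 * i)) mod modulus k = (- (2 * i')) mod modulus k"
    "(- (2 * j)) mod modulus k = (- (2 * j')) mod modulus k"
    using modulus_pos[of k] by (simp_all add: rot_def)
  then show ?thesis
    using double_mod_inj[of i k i'] double_mod_inj[of j k j'] assms(2-5) by simp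
qed

end

sublocale lamp_group \<subseteq> Z: locally_finite_by_int G height t
  by (rule locally_finite_by_int)

context lamp_group
begin

lemma near_in_lamp_part:
  assumes x: "x \<in> carrier G" and y: "y \<in> carrier G"
    and near: "inv x \<otimes> y \<in> word_ball G {t, a, b} R"
    and par: "even (height x div (int R + 1)) \<longleftrightarrow> even (height y div (int R + 1))"
  shows "y \<in> Z.part (int R + 1) (lamp_subgroup (3 * R)) x"
proof (rule Z.near_in_part[OF _ x y par])
  show "0 < int R + 1" by simp
  show "\<bar>height (inv x \<otimes> y)\<bar> < int R + 1" using word_ball_lamps[OF near] by simp
  fix p q assume pq: "p \<in> {0..<int R + 1}" "q \<in> {0..<int R + 1}" "p + height (inv x \<otimes> y) = q"
  let ?g = "t [^] p \<otimes> (inv x \<otimes> y) \<otimes> t [^] (- q)"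
  have "nat \<bar>p\<bar> \<le> R" "nat \<bar>- q\<bar> \<le> R" using pq(1,2) by auto
  then have "t [^] p \<in> word_ball G {t, a, b} R" "t [^] (- q) \<in> word_ball G {t, a, b} R"
    using t_pow_word_ball word_ball_mono[OF gens_subset] by blast+
  then have "?g \<in> word_ball G {t, a, b} (R + R + R)"
    using near by (intro word_ball_mult[OF gens_subset])
  also have "R + R + R = 3 * R" by simp
  finally have g: "?g \<in> word_ball G {t, a, b} (3 * R)" .
  have "height ?g = 0" using x y pq(3) by (simp add: height_mult Z.h_t_pow)
  then show "?g \<in> lamp_subgroup (3 * R)" using word_ball_lamps[OF g] x y by simp
qed

text \<open>
  Since \<open>k \<notin> M\<close>, all coordinates of \<open>M\<close> from \<open>k\<close> on have lamps that are too far apart to interact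
  within the reach, so the piece is bounded by the coordinates below \<open>k\<close>.
\<close>

lemma lamp_part_card:
  assumes "k \<notin> M" "x \<in> carrier G"
  defines "P \<equiv> Z.part (int (reach k) + 1) (lamp_subgroup (3 * reach k)) x"
  shows "finite P" "k * card P < side k"
proof -
  have far: "2 * (3 * reach k) < sep j" if "j \<in> M" "k \<le> j" for j
  proof -
    have "k < j" using that assms(1) by (metis le_neq_implies_less)
    then show ?thesis using reach_lt_sep[of k j] by simp
  qed
  note lamp = lamp_subgroup_finite_card[OF far]
  note part = Z.part_finite_card[OF _ lamp(1) lamp_subgroup_closed assms(2), of "int (reach k) + 1"]
  show "finite P" unfolding P_def by (rule part(1)) auto
  have "card P \<le> nat (int (reach k) + 1) * card (lamp_subgroup (3 * reach k))"
    unfolding P_def by (rule part(2)) auto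
  also have "\<dots> \<le> (reach k + 1) * lamp_bound k (3 * reach k) (cap k)"
    using lamp(2) by (intro mult_mono) auto
  finally have "k * card P \<le> k * ((reach k + 1) * lamp_bound k (3 * reach k) (cap k))"
    by (rule mult_left_mono) simp
  then show "k * card P < side k" unfolding side_def span_from_def by linarith
qed

end

section \<open>Regular maps between the groups\<close>

text \<open>
  The grid of a large coordinate \<open>k \<in> M - M'\<close> is mapped to the group of \<open>M'\<close> and coloured by the parity of
  the block.  Monochromatic components are mapped into single pieces.  Both the Lipschitz
  constant with respect to the standard generators and the size of the fibres are at most \<open>k\<close>,
  so the components are smaller than the side of the grid.
\<close>

theorem no_regular_map:
  assumes G: "lamp_group G M \<phi> t a b" and H: "lamp_group H M' \<phi>' t' a' b'"
    and inf: "infinite (M - M')"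
  shows "\<not> regular_map_exists G H"
proof
  interpret G: lamp_group G M \<phi> t a b by fact
  interpret H: lamp_group H M' \<phi>' t' a' b' by fact
  let ?S = "{t, a, b}" and ?T = "{t', a', b'}"
  assume "regular_map_exists G H"
  then obtain S T F where S: "finite_generating_set G S" and T: "finite_generating_set H T"
    and F: "regular_map (carrier G) (cayley_edges G S) (carrier H) (cayley_edges H T) F"
    unfolding regular_map_exists_def by blast
  from S have S: "finite S" "S \<subseteq> carrier G" "generate G S = carrier G"
    by (auto simp: finite_generating_set_def)
  from T have T: "finite T" "T \<subseteq> carrier H" "generate H T = carrier H"
    by (auto simp: finite_generating_set_def)
  from F obtain \<kappa> where Fc: "F \<in> carrier G \<rightarrow> carrier H"
    and lip_all: "\<forall>x\<in>carrier G. \<forall>x'\<in>carrier G.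
      graph_dist (cayley_edges H T) (F x) (F x') \<le> enat \<kappa> * graph_dist (cayley_edges G S) x x'"
    and fib_all: "\<forall>y\<in>carrier H. finite {x \<in> carrier G. F x = y} \<and> card {x \<in> carrier G. F x = y} \<le> \<kappa>"
    unfolding regular_map_def by blast
  note lip = bspec[OF bspec[OF lip_all]] and fib = bspec[OF fib_all]
  obtain c1 where c1: "?S \<subseteq> word_ball G S c1"
    using G.finite_subset_word_ball[OF S(2,3), of ?S] by auto
  obtain c2 where c2: "T \<subseteq> word_ball H ?T c2"
    using H.finite_subset_word_ball[OF H.gens_subset H.generates T(1,2)] by auto
  have F_near: "inv\<^bsub>H\<^esub> (F x) \<otimes>\<^bsub>H\<^esub> F y \<in> word_ball H ?T (\<kappa> * (n * c1) * c2)"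
    if x: "x \<in> carrier G" and y: "y \<in> carrier G" and n: "inv\<^bsub>G\<^esub> x \<otimes>\<^bsub>G\<^esub> y \<in> word_ball G ?S n" for x y n
  proof -
    have Fxy: "F x \<in> carrier H" "F y \<in> carrier H" using Fc x y by auto
    have "inv\<^bsub>G\<^esub> x \<otimes>\<^bsub>G\<^esub> y \<in> word_ball G S (n * c1)" using G.word_ball_rescale[OF S(2) c1] n by blast
    then have "graph_dist (cayley_edges G S) x y \<le> enat (n * c1)"
      using G.graph_dist_le_iff[OF S(2) x y] by blast
    then have "enat \<kappa> * graph_dist (cayley_edges G S) x y \<le> enat \<kappa> * enat (n * c1)"
      by (rule mult_left_mono) simp
    with lip[OF x y] have "graph_dist (cayley_edges H T) (F x) (F y) \<le> enat (\<kappa> * (n * c1))"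
      by simp
    then have "inv\<^bsub>H\<^esub> (F x) \<otimes>\<^bsub>H\<^esub> F y \<in> word_ball H T (\<kappa> * (n * c1))"
      using H.graph_dist_le_iff[OF T(2) Fxy] by blast
    then show ?thesis using H.word_ball_rescale[OF H.gens_subset c2] by blast
  qed
  obtain k where k: "k \<in> M" "k \<notin> M'" "\<kappa> * c1 * c2 + \<kappa> \<le> k"
    using inf by (metis DiffE finite_nat_set_iff_bounded not_less)
  let ?R = "reach k" and ?n = "8 * sep k + 10" and ?p = "side k"
  let ?W = "int ?R + 1" and ?K = "H.lamp_subgroup (3 * ?R)"
  have "\<kappa> * (?n * c1) * c2 = \<kappa> * c1 * c2 * ?n" by simp
  also have "\<dots> \<le> k * ?n" using k(3) by (intro mult_right_mono) auto
  finally have reach: "\<kappa> * (?n * c1) * c2 \<le> ?R" by (simp add: reach_def)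
  define pt where "pt v = G.grid_point k (int (fst v)) (int (snd v))" for v :: "nat \<times> nat"
  define \<Phi> where "\<Phi> v = F (pt v)" for v
  have pt_closed [simp]: "pt v \<in> carrier G" for v by (simp add: pt_def)
  have \<Phi>_closed [simp]: "\<Phi> v \<in> carrier H" for v using Fc unfolding \<Phi>_def by (auto simp: Pi_def)
  define c where "c v \<longleftrightarrow> even (H.height (\<Phi> v) div ?W)" for v
  let ?E = "king_step ?p c"
  have adjacent: "\<Phi> w \<in> H.Z.part ?W ?K (\<Phi> v)" if "(v, w) \<in> ?E" for v w
  proof (rule H.near_in_lamp_part)
    have "inv\<^bsub>G\<^esub> (pt v) \<otimes>\<^bsub>G\<^esub> pt w \<in> word_ball G ?S ?n"
      unfolding pt_def G.grid_point_step[OF k(1)]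
      using that by (intro G.grid_point_word_ball) (auto simp: king_step_def)
    from F_near[OF _ _ this] show "inv\<^bsub>H\<^esub> (\<Phi> v) \<otimes>\<^bsub>H\<^esub> \<Phi> w \<in> word_ball H ?T ?R"
      using H.word_ball_mono[OF H.gens_subset reach] by (auto simp: \<Phi>_def)
    show "even (H.height (\<Phi> v) div ?W) \<longleftrightarrow> even (H.height (\<Phi> w) div ?W)"
      using that by (auto simp: king_step_def c_def)
  qed simp_all
  have path: "\<Phi> w \<in> H.Z.part ?W ?K (\<Phi> u)" if "(u, w) \<in> ?E\<^sup>*" for u w
    using that
  proof (induction rule: rtrancl_induct)
    case base
    show ?case by (rule H.Z.part_self[OF H.subgroup_lamp_subgroup \<Phi>_closed])
  next
    case (step v w)
    then show ?case
      using H.Z.part_eq[OF H.subgroup_lamp_subgroup \<Phi>_closed step.IH] adjacent by blast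
  qed
  have "0 < ?p" by (simp add: side_def span_from_def)
  then obtain u where u: "fst u \<le> ?p" "snd u \<le> ?p" "?p < card (?E\<^sup>* `` {u})"
    using two_colouring_large_component by blast
  let ?C = "?E\<^sup>* `` {u}" and ?P = "H.Z.part ?W ?K (\<Phi> u)"
  note P = H.lamp_part_card[OF k(2) \<Phi>_closed, of u]
  have PH: "?P \<subseteq> carrier H" by (auto simp: H.Z.part_def)
  have "inj_on pt ?C"
  proof (rule inj_onI)
    fix v w assume v: "v \<in> ?C" and w: "w \<in> ?C" and eq: "pt v = pt w"
    have "fst v \<le> ?p \<and> snd v \<le> ?p" "fst w \<le> ?p \<and> snd w \<le> ?p"
      using king_path_in_grid[of u _ ?p c] u v w by auto
    then have "int (fst v) = int (fst w) \<and> int (snd v) = int (snd w)"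
      using G.grid_point_inj[OF k(1) _ _ _ _ eq[unfolded pt_def]] by simp
    then show "v = w" by (simp add: prod_eq_iff)
  qed
  then have "card ?C = card (pt ` ?C)" by (simp add: card_image)
  also have "\<dots> \<le> card (\<Union>y\<in>?P. {x \<in> carrier G. F x = y})"
  proof (rule card_mono)
    show "finite (\<Union>y\<in>?P. {x \<in> carrier G. F x = y})" using P(1) fib PH by blast
    show "pt ` ?C \<subseteq> (\<Union>y\<in>?P. {x \<in> carrier G. F x = y})" using path by (auto simp: \<Phi>_def)
  qed
  also have "\<dots> \<le> (\<Sum>y\<in>?P. card {x \<in> carrier G. F x = y})" using P(1) by (rule card_UN_le)
  also have "\<dots> \<le> (\<Sum>y\<in>?P. \<kappa>)" using fib PH by (intro sum_mono) blast
  also have "\<dots> = \<kappa> * card ?P" by simp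
  also have "\<dots> \<le> k * card ?P" using k(3) by (intro mult_right_mono) auto
  finally show False using u(3) P(2) by linarith
qed

section \<open>Uncountably many groups\<close>

lemma lamp_group_exists: "\<exists>(G :: nat monoid) \<phi> t a b. lamp_group G M \<phi> t a b"
proof -
  interpret P: group "perm_group :: (point \<Rightarrow> point) monoid" by (rule group_perm_group)
  let ?S = "{shift 1, lamp M 0 (\<lambda>_. 0), lamp M 1 (\<lambda>j. int (sep j))}"
  have S: "?S \<subseteq> carrier perm_group"
    using bij_lamp perm_group_one_parameter(2)[of shift 1, OF shift_add shift_0] by simp
  have "countable (generate perm_group ?S)" using S by (intro P.countable_generate) auto
  then obtain G :: "nat monoid" and \<phi> where G: "group G" "\<phi> \<in> hom G perm_group" "inj_on \<phi> (carrier G)"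
    and img: "\<phi> ` carrier G = generate perm_group ?S"
    using P.nat_copy_of_subgroup[OF P.generate_is_subgroup[OF S]] by blast
  have "x \<in> \<phi> ` carrier G" if "x \<in> ?S" for x using that unfolding img by (rule generate.incl)
  then obtain t a b where tab: "t \<in> carrier G" "\<phi> t = shift 1" "a \<in> carrier G" "\<phi> a = lamp M 0 (\<lambda>_. 0)"
    "b \<in> carrier G" "\<phi> b = lamp M 1 (\<lambda>j. int (sep j))"
    by (metis (no_types, lifting) imageE insertCI)
  interpret \<phi>: group_hom G perm_group \<phi>
    using G group_perm_group by (simp add: group_hom_def group_hom_axioms_def)
  have sub: "{t, a, b} \<subseteq> carrier G" using tab by simp
  have "\<phi> ` generate G {t, a, b} = \<phi> ` carrier G"
    using \<phi>.generate_img[OF sub] tab img by simp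
  then have gen: "generate G {t, a, b} = carrier G"
    using inj_on_image_eq_iff[OF G(3), of "generate G {t, a, b}" "carrier G"]
      group.generate_incl[OF G(1) sub] by simp
  have "lamp_group G M \<phi> t a b"
    using G tab gen by (simp add: lamp_group_def lamp_group_axioms_def)
  then show ?thesis by blast
qed

text \<open>
  The branch of binary approximations of \<open>r\<close>, coded by natural numbers.  Two branches separate at
  some level and have no common code from there on.
\<close>

definition dyadic_codes :: "real \<Rightarrow> nat set" where
  "dyadic_codes r = range (\<lambda>n::nat. to_nat (n, \<lfloor>r * 2 ^ n\<rfloor>))"

lemma infinite_dyadic_codes_diff:
  assumes "r \<noteq> s"
  shows "infinite (dyadic_codes s - dyadic_codes r)"
proof -
  obtain N :: nat where N: "1 / \<bar>r - s\<bar> < 2 ^ N" using real_arch_pow[of 2 "1 / \<bar>r - s\<bar>"] by auto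
  have neq: "\<lfloor>s * 2 ^ n\<rfloor> \<noteq> \<lfloor>r * 2 ^ n\<rfloor>" if "N \<le> n" for n
  proof
    assume "\<lfloor>s * 2 ^ n\<rfloor> = \<lfloor>r * 2 ^ n\<rfloor>"
    then have "\<bar>r * 2 ^ n - s * 2 ^ n\<bar> < 1" by linarith
    then have "\<bar>r - s\<bar> * 2 ^ n < 1" by (simp add: abs_mult flip: left_diff_distrib)
    moreover have "(2::real) ^ N \<le> 2 ^ n" using that by simp
    ultimately have "\<bar>r - s\<bar> * 2 ^ N < 1" by (meson abs_ge_zero le_less_trans mult_left_mono)
    then show False using N assms by (simp add: divide_less_eq mult.commute)
  qed
  let ?f = "\<lambda>n::nat. to_nat (n, \<lfloor>s * 2 ^ n\<rfloor>)"
  have "?f ` {N..} \<subseteq> dyadic_codes s - dyadic_codes r"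
    using neq by (auto simp: dyadic_codes_def)
  moreover have "infinite (?f ` {N..})"
    by (subst finite_image_iff) (auto simp: inj_on_def infinite_Ici)
  ultimately show ?thesis by (meson finite_subset)
qed

theorem theorem5:
  "\<exists>G :: real \<Rightarrow> nat monoid.
     (\<forall>r. finitely_generated_group (G r) \<and> amenable_group (G r) \<and> group_asdim_eq (G r) 1) \<and>
     (\<forall>r s. r \<noteq> s \<longrightarrow> \<not> regular_map_exists (G s) (G r))"
proof -
  have "\<exists>G :: real \<Rightarrow> nat monoid. \<forall>r. \<exists>\<phi> t a b. lamp_group (G r) (dyadic_codes r) \<phi> t a b"
    by (rule choice) (intro allI lamp_group_exists)
  then obtain G :: "real \<Rightarrow> nat monoid" where
    G: "\<forall>r. \<exists>\<phi> t a b. lamp_group (G r) (dyadic_codes r) \<phi> t a b" by (elim exE)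
  show ?thesis
  proof (intro exI[of _ G] conjI allI impI)
    fix r
    obtain \<phi> t a b where "lamp_group (G r) (dyadic_codes r) \<phi> t a b"
      using spec[OF G, of r] by (elim exE)
    then interpret lamp_group "G r" "dyadic_codes r" \<phi> t a b .
    show fg: "finitely_generated_group (G r)"
      unfolding finitely_generated_group_def
    proof (intro conjI exI)
      show "group (G r)" by (rule is_group)
      show "finite_generating_set (G r) {t, a, b}"
        using generates gens_subset unfolding finite_generating_set_def by (intro conjI) simp_all
    qed
    show "amenable_group (G r)" by (rule Z.amenable)
    show "group_asdim_eq (G r) 1"
      unfolding group_asdim_eq_def finite_generating_set_def
      using fg Z.asdim_one by blast
  next
    fix r s :: real assume "r \<noteq> s"
    obtain \<phi> t a b where "lamp_group (G s) (dyadic_codes s) \<phi> t a b"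
      using spec[OF G, of s] by (elim exE)
    moreover obtain \<phi>' t' a' b' where "lamp_group (G r) (dyadic_codes r) \<phi>' t' a' b'"
      using spec[OF G, of r] by (elim exE)
    ultimately show "\<not> regular_map_exists (G s) (G r)"
      using infinite_dyadic_codes_diff[OF \<open>r \<noteq> s\<close>] by (rule no_regular_map)
  qed
qed

end
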